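(* Let $(w,s)\in\mathbb C^2$ with $\Re(s)\notin\{\Re(w),0\}$ and $s\neq 0,w$. Then $$Z_{\mathbb Q}(w,s)=\int_0^\infty\bigl(\theta(t^2)^w-H(s)-H(w-s)t^{-w}\bigr)t^s\frac{dt}{t}=\int_{-\infty}^{\infty}\bigl(\theta(e^{2x})^w-H(s)-H(w-s)e^{-wx}\bigr)e^{sx}\,dx,$$ where both integrals converge absolutely.
   Context: $\theta(t)=\sum_{n\in\mathbb Z}e^{-\pi n^2t}$ for $t>0$; since $\theta(t)>0$, $\theta(t)^w=e^{w\log\theta(t)}$ with the real logarithm, and $t^s=e^{s\log t}$. $Z_{\mathbb Q}(w,s)$ is defined for $\Re(w)<\Re(s)<0$ by $\int_0^\infty\theta(t^2)^s\theta(1/t^2)^{w-s}\frac{dt}{t}$ and extended meromorphically to $\mathbb C^2$ (poles only along $s=0$ and $s=w$). For complex $s$ with $\Re(s)\ne0$, Heaviside's function is $H(s)=1$ if $\Re(s)>0$ and $H(s)=0$ if $\Re(s)<0$. *)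

theory Defs
  imports "HOL-Analysis.Analysis"
begin

definition theta :: "real \<Rightarrow> real" where
  "theta t = (\<Sum>\<^sub>\<infinity>n::int. exp (- pi * (of_int n)\<^sup>2 * t))"

text \<open>Only used for arguments with nonzero real part; the value \<open>0\<close> on the imaginary axis
  is immaterial.\<close>

definition heaviside :: "complex \<Rightarrow> complex" where
  "heaviside s = (if Re s > 0 then 1 else 0)"

text \<open>The library's \<open>holomorphic_on\<close> covers one complex variable only. A function of two complex
  variables is holomorphic on an open set if it is Frechet differentiable at every point with a
  complex-linear derivative.\<close>

definition holomorphic2_on :: "(complex \<times> complex \<Rightarrow> complex) \<Rightarrow> (complex \<times> complex) set \<Rightarrow> bool" where
  "holomorphic2_on f S \<longleftrightarrow>
     (\<forall>p\<in>S. \<exists>a b. (f has_derivative (\<lambda>(h, k). a * h + b * k)) (at p))"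

text \<open>Meromorphic on an open set: locally a quotient of two holomorphic functions. As \<open>V\<close> is
  connected, \<open>h\<close> not vanishing identically on \<open>V\<close> makes its zero set in \<open>V\<close> nowhere dense.\<close>

definition meromorphic2_on :: "(complex \<times> complex \<Rightarrow> complex) \<Rightarrow> (complex \<times> complex) set \<Rightarrow> bool" where
  "meromorphic2_on f S \<longleftrightarrow>
     (\<forall>p\<in>S. \<exists>V g h. open V \<and> connected V \<and> p \<in> V \<and> V \<subseteq> S \<and>
        holomorphic2_on g V \<and> holomorphic2_on h V \<and> (\<exists>q\<in>V. h q \<noteq> 0) \<and>
        (\<forall>q\<in>V. h q \<noteq> 0 \<longrightarrow> f q = g q / h q))"

text \<open>For a positive real \<open>x\<close>, \<open>complex_of_real x powr z\<close> is \<open>exp (z * ln x)\<close> with the real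
  logarithm.\<close>

definition ZQ_integral :: "complex \<Rightarrow> complex \<Rightarrow> complex" where
  "ZQ_integral w s =
     (LINT t:{0<..}|lborel.
        complex_of_real (theta (t\<^sup>2)) powr s * complex_of_real (theta (1 / t\<^sup>2)) powr (w - s)
          / complex_of_real t)"

text \<open>The meromorphic continuation of the integral to all pairs \<open>(w, s)\<close>, with poles only along the
  lines \<open>s = 0\<close> and \<open>s = w\<close>. Functions in HOL are total, so the value on these two lines is fixed
  to be \<open>0\<close>; this makes the continuation unique as a function.\<close>

definition is_ZQ_continuation :: "(complex \<times> complex \<Rightarrow> complex) \<Rightarrow> bool" where
  "is_ZQ_continuation f \<longleftrightarrow>
     meromorphic2_on f UNIV \<and>
     holomorphic2_on f {(w, s). s \<noteq> 0 \<and> s \<noteq> w} \<and>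
     (\<forall>w s. Re w < Re s \<and> Re s < 0 \<longrightarrow> f (w, s) = ZQ_integral w s) \<and>
     (\<forall>w s. s = 0 \<or> s = w \<longrightarrow> f (w, s) = 0)"

definition ZQ :: "complex \<Rightarrow> complex \<Rightarrow> complex" where
  "ZQ w s = (THE f. is_ZQ_continuation f) (w, s)"

end

theory Submission
  imports Defs "HOL-Probability.Characteristic_Functions" "HOL-Complex_Analysis.Conformal_Mappings"
begin

text \<open>
  Put \<open>L(x) = ln \<theta>(exp (2x))\<close>. The inversion formula \<open>\<theta>(1/t) = \<surd>t \<theta>(t)\<close> reads \<open>L(-x) = L(x) + x\<close>, and
  \<open>L\<close> decays doubly exponentially at \<open>+\<infinity>\<close>, so that
  \<open>A(w, s) = \<integral>\<^sub>0\<^sup>\<infinity> (exp (w L(x)) - 1) exp (s x) dx\<close> is entire in \<open>(w, s)\<close>. On the half-line \<open>x > 0\<close> the regularized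
  integrand is the integrand of \<open>A(w, s)\<close> plus decaying exponentials, and the reflection \<open>x \<mapsto> -x\<close>
  exchanges \<open>s\<close> and \<open>w - s\<close>. Hence, whatever the signs of \<open>Re s\<close> and \<open>Re (w - s)\<close>, the integral equals
  \<open>A(w, s) + A(w, w - s) - 1/s - 1/(w - s)\<close>. This expression is the meromorphic continuation, which is
  unique by the identity theorem in one variable, applied first in \<open>s\<close> (for \<open>Re w < 0\<close>) and then in \<open>w\<close>.

  The inversion formula is Poisson summation: \<open>\<Sum>\<^sub>n exp (-\<pi>(n + x)\<^sup>2t)\<close> and
  \<open>(1/\<surd>t) \<Sum>\<^sub>k exp (-\<pi>k\<^sup>2/t) cos (2\<pi>kx)\<close> are continuous, symmetric under \<open>x \<mapsto> 1 - x\<close>, and have the same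
  cosine coefficients on \<open>[0, 1]\<close>.
\<close>

subsection \<open>Uniqueness of cosine coefficients\<close>

text \<open>The majorant \<open>M\<close> makes the partial sums converge uniformly on [0, 1], so
  summation and integration may be exchanged. It is applied to both sides of the Poisson
  formula.\<close>

lemma uniform_series_cos_coeff:
  fixes f :: "nat \<Rightarrow> real \<Rightarrow> real"
  assumes cont: "\<And>n. continuous_on {0..1} (f n)"
    and bound: "\<And>n x. x \<in> {0..1} \<Longrightarrow> \<bar>f n x\<bar> \<le> M n" and M: "summable M"
    and sums: "(\<lambda>n. integral {0..1} (\<lambda>x. f n x * cos (c * x))) sums I"
  shows "((\<lambda>x. (\<Sum>n. f n x) * cos (c * x)) has_integral I) {0..1}"
proof -
  have "uniform_limit {0..1} (\<lambda>n x. \<Sum>i<n. f i x * cos (c * x)) (\<lambda>x. \<Sum>i. f i x * cos (c * x)) sequentially"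
  proof (rule Weierstrass_m_test[OF _ M])
    fix n and x :: real assume "x \<in> {0..1}"
    then show "norm (f n x * cos (c * x)) \<le> M n"
      using bound[of x n] mult_mono[OF bound[of x n] abs_cos_le_one[of "c * x"]] by (auto simp: abs_mult)
  qed
  moreover have "continuous_on {0..1} (\<lambda>x. \<Sum>i<n. f i x * cos (c * x))" for n
    by (intro continuous_intros cont)
  ultimately obtain J K where J: "\<And>n. ((\<lambda>x. \<Sum>i<n. f i x * cos (c * x)) has_integral J n) {0..1}"
    and K: "((\<lambda>x. \<Sum>i. f i x * cos (c * x)) has_integral K) {0..1}" and lim: "J \<longlonglongrightarrow> K"
    by (rule uniform_limit_integral) auto
  have "J n = (\<Sum>i<n. integral {0..1} (\<lambda>x. f i x * cos (c * x)))" for n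
    using J[of n] by (subst integral_sum[symmetric])
      (auto intro!: integrable_continuous_interval continuous_intros cont simp: integral_unique)
  then have "J = (\<lambda>n. \<Sum>i<n. integral {0..1} (\<lambda>x. f i x * cos (c * x)))" by (rule ext)
  then have "J \<longlonglongrightarrow> I" using sums by (simp add: sums_def)
  then have KI: "K = I" using lim LIMSEQ_unique by blast
  have eq: "(\<Sum>i. f i x * cos (c * x)) = (\<Sum>i. f i x) * cos (c * x)" if "x \<in> {0..1}" for x
    by (rule suminf_mult2[symmetric], rule summable_comparison_test'[OF M, of 0]) (use bound that in auto)
  show ?thesis by (rule has_integral_eq[OF eq K[unfolded KI]])
qed

lemma uniform_series_continuous:
  fixes f :: "nat \<Rightarrow> real \<Rightarrow> real"
  assumes cont: "\<And>n. continuous_on S (f n)"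
    and bound: "\<And>n x. x \<in> S \<Longrightarrow> \<bar>f n x\<bar> \<le> M n" and M: "summable M"
  shows "continuous_on S (\<lambda>x. \<Sum>n. f n x)"
proof (rule uniform_limit_theorem)
  show "uniform_limit S (\<lambda>n x. \<Sum>i<n. f i x) (\<lambda>x. \<Sum>i. f i x) sequentially"
    by (rule Weierstrass_m_test[OF _ M]) (use bound in auto)
  show "\<forall>\<^sub>F n in sequentially. continuous_on S (\<lambda>x. \<Sum>i<n. f i x)"
    by (intro always_eventually allI continuous_intros cont)
qed simp

text \<open>By symmetry \<open>D\<close> is a continuous function of \<open>cos (2\<pi>x)\<close>, so polynomials in \<open>cos (2\<pi>x)\<close>, to which
  \<open>D\<close> is orthogonal, approximate it uniformly.\<close>

lemma eq_0_if_cos_coeffs_0: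
  fixes D :: "real \<Rightarrow> real"
  assumes cont: "continuous_on {0..1} D"
    and sym: "\<And>x. x \<in> {0..1} \<Longrightarrow> D (1 - x) = D x"
    and coeff: "\<And>k::nat. ((\<lambda>x. D x * cos (2 * pi * k * x)) has_integral 0) {0..1}"
    and x: "x \<in> {0..1}"
  shows "D x = 0"
proof -
  \<comment> \<open>The product formula writes cos(2 pi x) cos(2 pi k x) as half the sum of the
    cosines of frequencies k + 1 and k - 1, so the induction on \<open>n\<close> needs the claim for
    all \<open>k\<close> at once.\<close>
  have mom: "\<forall>k::nat. ((\<lambda>x. D x * cos (2 * pi * x) ^ n * cos (2 * pi * k * x)) has_integral 0) {0..1}" for n
  proof (induction n)
    case 0
    then show ?case using coeff by simp
  next
    case (Suc n)
    show ?case
    proof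
      fix k :: nat
      show "((\<lambda>x. D x * cos (2 * pi * x) ^ Suc n * cos (2 * pi * k * x)) has_integral 0) {0..1}"
      proof (cases k)
        case 0
        \<comment> \<open>There is no natural frequency k - 1 here, but the additional cosine factor
          is itself the one of frequency 1.\<close>
        then show ?thesis using Suc[rule_format, of 1] by (simp add: mult_ac)
      next
        case (Suc m)
        have "((\<lambda>x. (D x * cos (2 * pi * x) ^ n * cos (2 * pi * (real (Suc k)) * x)
            + D x * cos (2 * pi * x) ^ n * cos (2 * pi * (real m) * x)) * (1 / 2)) has_integral (0 + 0) * (1 / 2)) {0..1}"
          using Suc.IH by (intro has_integral_mult_left has_integral_add) blast+
        moreover have "(D x * cos (2 * pi * x) ^ n * cos (2 * pi * (real (Suc k)) * x)
            + D x * cos (2 * pi * x) ^ n * cos (2 * pi * (real m) * x)) * (1 / 2)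
            = D x * cos (2 * pi * x) ^ Suc n * cos (2 * pi * k * x)" for x
        proof -
          have "cos (2 * pi * (real (Suc k)) * x) + cos (2 * pi * (real m) * x) = 2 * (cos (2 * pi * x) * cos (2 * pi * k * x))"
          proof -
            have "2 * pi * (real (Suc k)) * x = 2 * pi * k * x + 2 * pi * x" "2 * pi * (real m) * x = 2 * pi * k * x - 2 * pi * x"
              by (simp_all add: Suc algebra_simps)
            then show ?thesis by (simp only: cos_add cos_diff) (simp add: mult.commute)
          qed
          then show ?thesis unfolding distrib_left[symmetric] by simp
        qed
        ultimately show ?thesis by simp
      qed
    qed
  qed
  \<comment> \<open>\<open>h\<close> is \<open>D\<close> in the coordinate y = cos(2 pi x). As
    \<open>arccos\<close> recovers only x in [0, 1/2], the other half in \<open>Dh\<close> comes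
    from the symmetry of \<open>D\<close>.\<close>
  define h where "h y = D (arccos y / (2 * pi))" for y
  have range: "arccos y / (2 * pi) \<in> {0..1}" if "y \<in> {-1..1}" for y
    using arccos_lbound[of y] arccos_ubound[of y] that pi_gt_zero by (auto simp: field_simps)
  have conth: "continuous_on {-1..1} h" unfolding h_def
    by (rule continuous_on_compose2[OF cont]) (use range in \<open>auto intro!: continuous_intros\<close>)
  have Dh: "D x = h (cos (2 * pi * x))" if x: "x \<in> {0..1}" for x
  proof (cases "x \<le> 1 / 2")
    case True
    then have "arccos (cos (2 * pi * x)) = 2 * pi * x" using x by (intro arccos_cos) (auto simp: field_simps)
    then show ?thesis by (simp add: h_def)
  next
    case False
    have "cos (2 * pi * x) = cos (2 * pi * (1 - x))" by (simp add: right_diff_distrib cos_diff)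
    moreover have "arccos (cos (2 * pi * (1 - x))) = 2 * pi * (1 - x)" using x False
      by (intro arccos_cos) (auto simp: field_simps)
    ultimately show ?thesis using sym[OF x] by (simp add: h_def)
  qed
  have int2: "(\<lambda>x. D x * D x) integrable_on {0..1}" and intabs: "(\<lambda>x. \<bar>D x\<bar>) integrable_on {0..1}"
    by (intro integrable_continuous_interval continuous_intros cont)+
  \<comment> \<open>If the polynomial p is within e of \<open>h\<close>, then \<open>D\<close> is
    orthogonal to p(cos(2 pi x)), so the integral of D^2 equals that of D (D - p(cos(2 pi
    x))).\<close>
  have le: "integral {0..1} (\<lambda>x. D x * D x) \<le> e * integral {0..1} (\<lambda>x. \<bar>D x\<bar>)" if "e > 0" for e
  proof -
    obtain p where p: "real_polynomial_function p" "\<And>y. y \<in> {-1..1} \<Longrightarrow> \<bar>h y - p y\<bar> < e"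
      using Stone_Weierstrass_real_polynomial_function[OF _ conth \<open>e > 0\<close>] by auto
    obtain a n where an: "p = (\<lambda>y. \<Sum>i\<le>n. a i * y ^ i)"
      using p(1) real_polynomial_function_iff_sum by blast
    \<comment> \<open>The cosine of frequency 0 equals 1; it gives the summands the form of
      \<open>mom\<close>.\<close>
    have "((\<lambda>x. \<Sum>i\<le>n. a i * (D x * cos (2 * pi * x) ^ i * cos (2 * pi * real 0 * x))) has_integral (\<Sum>i\<le>n. a i * 0)) {0..1}"
      by (intro has_integral_sum has_integral_mult_right mom[rule_format]) auto
    then have p0: "((\<lambda>x. D x * p (cos (2 * pi * x))) has_integral 0) {0..1}"
      by (simp add: an sum_distrib_left mult_ac)
    have "integral {0..1} (\<lambda>x. D x * D x) = integral {0..1} (\<lambda>x. D x * D x - D x * p (cos (2 * pi * x)))"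
      using int2 p0 by (subst integral_diff) (auto simp: integral_unique)
    also have "\<dots> \<le> integral {0..1} (\<lambda>x. e * \<bar>D x\<bar>)"
    proof (rule integral_le)
      fix x :: real assume x: "x \<in> {0..1}"
      have "D x * D x - D x * p (cos (2 * pi * x)) = D x * (h (cos (2 * pi * x)) - p (cos (2 * pi * x)))"
        using Dh[OF x] by (simp add: algebra_simps)
      also have "\<dots> \<le> \<bar>D x\<bar> * e"
      proof (rule order_trans[OF abs_ge_self])
        have "\<bar>h (cos (2 * pi * x)) - p (cos (2 * pi * x))\<bar> \<le> e"
          using p(2)[of "cos (2 * pi * x)"] by auto
        then show "\<bar>D x * (h (cos (2 * pi * x)) - p (cos (2 * pi * x)))\<bar> \<le> \<bar>D x\<bar> * e"
          unfolding abs_mult by (rule mult_left_mono) auto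
      qed
      finally show "D x * D x - D x * p (cos (2 * pi * x)) \<le> e * \<bar>D x\<bar>" by (simp add: mult_ac)
    qed (use int2 p0 intabs in \<open>auto intro!: integrable_diff integrable_on_mult_right\<close>)
    finally show ?thesis by simp
  qed
  have "integral {0..1} (\<lambda>x. D x * D x) \<le> 0 + d" if "d > 0" for d
  proof -
    let ?M = "integral {0..1} (\<lambda>x. \<bar>D x\<bar>)"
    have M: "?M \<ge> 0" by (rule integral_nonneg[OF intabs]) auto
    \<comment> \<open>Dividing by \<open>?M + 1\<close> instead of \<open>?M\<close> covers the case
      \<open>?M = 0\<close>.\<close>
    have "d / (?M + 1) * ?M \<le> d" using M \<open>d > 0\<close> by (simp add: field_simps)
    then show ?thesis using le[of "d / (?M + 1)"] M \<open>d > 0\<close> by auto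
  qed
  then have "integral {0..1} (\<lambda>x. D x * D x) \<le> 0" by (rule field_le_epsilon)
  moreover have "integral {0..1} (\<lambda>x. D x * D x) \<ge> 0" by (rule integral_nonneg[OF int2]) auto
  ultimately have "integral {0..1} (\<lambda>x. D x * D x) = 0" by simp
  then have "\<forall>x\<in>{0..1}. D x * D x = 0"
    by (subst (asm) integral_eq_0_iff) (auto intro!: continuous_intros cont)
  then show ?thesis using x by auto
qed

section \<open>Fourier data: Gaussian integral, cosine orthogonality, theta as an ordinary
  series\<close>

text \<open>This is the characteristic function exp(-u^2/2) of the standard normal distribution
  after a linear change of variable.\<close>

lemma gaussian_fourier:
  assumes "t > 0"
  shows "integrable lborel (\<lambda>x::real. exp (- pi * x\<^sup>2 * t) * cos (2 * pi * k * x))"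
    and "(LBINT x. exp (- pi * x\<^sup>2 * t) * cos (2 * pi * k * x)) = exp (- pi * k\<^sup>2 * (1 / t)) / sqrt t"
proof -
  \<comment> \<open>\<open>c\<close> and \<open>u\<close> are chosen so that (c x)^2 / 2 = pi x^2 t
    and u (c x) = 2 pi k x; then u^2 / 2 = pi k^2 / t.\<close>
  define c where "c = sqrt (2 * pi * t)"
  have c: "c > 0" "c\<^sup>2 = 2 * pi * t" using assms by (auto simp: c_def)
  define u where "u = 2 * pi * k / c"
  have "char std_normal_distribution u = (CLBINT x. std_normal_density x *\<^sub>R iexp (u * x))"
    unfolding char_def by (subst integral_density) auto
  then have ch: "(CLBINT x. std_normal_density x *\<^sub>R iexp (u * x)) = complex_of_real (exp (- (u\<^sup>2) / 2))"
    by (simp add: char_std_normal_distribution)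
  have intc: "integrable lborel (\<lambda>x. std_normal_density x *\<^sub>R iexp (u * x))"
    using integrable_std_normal_moment[of 0] by (rule Bochner_Integration.integrable_bound) auto
  have re: "Re (std_normal_density x *\<^sub>R iexp (u * x)) = std_normal_density x * cos (u * x)" for x
    by (simp add: Re_exp)
  have int: "integrable lborel (\<lambda>x. std_normal_density x * cos (u * x))"
    using integrable_Re[OF intc] unfolding re .
  have val: "(LBINT x. std_normal_density x * cos (u * x)) = exp (- (u\<^sup>2) / 2)"
    using integral_Re[OF intc] unfolding re ch by simp
  have eq: "std_normal_density (0 + c * x) * cos (u * (0 + c * x)) = (1 / sqrt (2 * pi)) * (exp (- pi * x\<^sup>2 * t) * cos (2 * pi * k * x))" for x
    using c by (simp add: std_normal_density_def power_mult_distrib u_def mult_ac)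
  have "integrable lborel (\<lambda>x. (1 / sqrt (2 * pi)) * (exp (- pi * x\<^sup>2 * t) * cos (2 * pi * k * x)))"
    using lborel_integrable_real_affine[OF int, of c 0] c unfolding eq by simp
  then show "integrable lborel (\<lambda>x::real. exp (- pi * x\<^sup>2 * t) * cos (2 * pi * k * x))"
    using integrable_mult_right[of "sqrt (2 * pi)" lborel "\<lambda>x. (1 / sqrt (2 * pi)) * (exp (- pi * x\<^sup>2 * t) * cos (2 * pi * k * x))"]
    unfolding mult.assoc[symmetric] by simp
  have "exp (- (u\<^sup>2) / 2) = c * ((1 / sqrt (2 * pi)) * (LBINT x. exp (- pi * x\<^sup>2 * t) * cos (2 * pi * k * x)))"
    using lborel_integral_real_affine[of c "\<lambda>x. std_normal_density x * cos (u * x)" 0] c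
    unfolding eq val integral_mult_right_zero by simp
  moreover have "c * (1 / sqrt (2 * pi)) = sqrt t" by (simp add: c_def real_sqrt_mult)
  moreover have "u\<^sup>2 / 2 = pi * k\<^sup>2 * (1 / t)"
    using c assms by (simp add: u_def power_divide power_mult_distrib) (simp add: power2_eq_square field_simps)
  ultimately show "(LBINT x. exp (- pi * x\<^sup>2 * t) * cos (2 * pi * k * x)) = exp (- pi * k\<^sup>2 * (1 / t)) / sqrt t"
    using assms by (simp add: field_simps)
qed

lemma integral_cos_period:
  "((\<lambda>x. cos (2 * pi * of_int m * x)) has_integral (if m = 0 then 1 else 0)) {0..1::real}"
proof (cases "m = 0")
  case True
  then show ?thesis using has_integral_const_real[of "1::real" 0 1] by simp
next
  case False
  have "((\<lambda>x. cos (2 * pi * of_int m * x)) has_integral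
     (sin (2 * pi * of_int m * 1) / (2 * pi * of_int m) - sin (2 * pi * of_int m * 0) / (2 * pi * of_int m))) {0..1::real}"
    using False by (intro fundamental_theorem_of_calculus)
      (auto intro!: derivative_eq_intros simp: has_real_derivative_iff_has_vector_derivative[symmetric])
  moreover have "sin (2 * pi * of_int m * 1) = 0" using sin_int_2pin[of m] by (simp only: mult_1_right)
  ultimately show ?thesis using False by simp
qed

lemma integral_cos_cos:
  fixes j k :: nat
  shows "integral {0..1} (\<lambda>x. cos (2 * pi * j * x) * cos (2 * pi * k * x))
    = (if j = k then if k = 0 then 1 else 1 / 2 else 0)"
proof (rule integral_unique)
  \<comment> \<open>The difference of the frequencies is formed in \<open>int\<close>, since
    subtraction in \<open>nat\<close> would truncate it.\<close>
  have "((\<lambda>x. (cos (2 * pi * of_int (int j - int k) * x) + cos (2 * pi * of_int (int j + int k) * x)) * (1 / 2)) has_integral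
    ((if int j - int k = 0 then 1 else 0) + (if int j + int k = 0 then 1 else 0)) * (1 / 2)) {0..1::real}"
    by (intro has_integral_mult_left has_integral_add integral_cos_period)
  moreover have "(cos (2 * pi * of_int (int j - int k) * x) + cos (2 * pi * of_int (int j + int k) * x)) * (1 / 2)
      = cos (2 * pi * j * x) * cos (2 * pi * k * x)" for x
  proof -
    have "2 * pi * of_int (int j - int k) * x = 2 * pi * j * x - 2 * pi * k * x"
      "2 * pi * of_int (int j + int k) * x = 2 * pi * j * x + 2 * pi * k * x"
      by (simp_all add: algebra_simps)
    then show ?thesis by (simp only: cos_times_cos)
  qed
  moreover have "((if int j - int k = 0 then 1 else 0) + (if int j + int k = 0 then 1 else 0)) * (1 / 2)
      = (if j = k then if k = 0 then 1 else 1 / 2 else (0::real))" by auto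
  ultimately show "((\<lambda>x. cos (2 * pi * j * x) * cos (2 * pi * k * x)) has_integral
      (if j = k then if k = 0 then 1 else 1 / 2 else 0)) {0..1}" by (simp only:)
qed

lemma summable_gaussian:
  fixes t :: real
  assumes "t > 0"
  shows "summable (\<lambda>n::nat. exp (- pi * (real n)\<^sup>2 * t))"
proof (rule summable_comparison_test')
  show "summable (\<lambda>n. exp (- pi * t) ^ n)" using assms by (intro summable_geometric) auto
  fix n :: nat
  have "real n \<le> (real n)\<^sup>2" by (cases n) (auto simp: power2_eq_square)
  then have "pi * t * real n \<le> pi * t * (real n)\<^sup>2" using assms by (intro mult_left_mono) auto
  then show "norm (exp (- pi * (real n)\<^sup>2 * t)) \<le> exp (- pi * t) ^ n"
    by (simp add: exp_of_nat_mult[symmetric] mult_ac)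
qed

text \<open>The terms of index n and -(n + 1) are paired, which enumerates all integers once and
  turns the unconditional sum into a series open to comparison and the Weierstrass test. The pairing
  is the same in the Poisson formula below.\<close>

lemma theta_sums:
  assumes "t > 0"
  shows "(\<lambda>n::nat. exp (- pi * (real n)\<^sup>2 * t) + exp (- pi * (real (Suc n))\<^sup>2 * t)) sums theta t"
proof -
  let ?f = "\<lambda>n::int. exp (- pi * (of_int n)\<^sup>2 * t)"
  let ?g = "\<lambda>n::nat. exp (- pi * (real n)\<^sup>2 * t)"
  have s0: "summable ?g" by (rule summable_gaussian[OF assms])
  then have s1: "summable (\<lambda>n. ?g (Suc n))" by (rule summable_Suc_iff[THEN iffD2])
  have h0: "(?g has_sum suminf ?g) UNIV" using s0 by (intro norm_summable_imp_has_sum) (auto simp: summable_sums)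
  have h1: "((\<lambda>n. ?g (Suc n)) has_sum (\<Sum>n. ?g (Suc n))) UNIV" using s1
    by (intro norm_summable_imp_has_sum summable_sums) auto
  have "(?f has_sum suminf ?g) (range int)"
    using h0 by (subst has_sum_reindex) (auto simp: o_def)
  moreover have "(?f has_sum (\<Sum>n. ?g (Suc n))) (range (\<lambda>n. - int (Suc n)))"
    using h1 by (subst has_sum_reindex) (auto simp: o_def inj_on_def power2_eq_square algebra_simps)
  moreover have "range int \<inter> range (\<lambda>n. - int (Suc n)) = {}" by auto
  ultimately have "(?f has_sum (suminf ?g + (\<Sum>n. ?g (Suc n)))) (range int \<union> range (\<lambda>n. - int (Suc n)))"
    by (intro has_sum_Un_disjoint)
  moreover have "range int \<union> range (\<lambda>n. - int (Suc n)) = UNIV"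
  proof -
    have "m \<in> range int \<union> range (\<lambda>n. - int (Suc n))" for m
      by (cases m) auto
    then show ?thesis by blast
  qed
  ultimately have "theta t = suminf ?g + (\<Sum>n. ?g (Suc n))" by (simp add: theta_def infsumI)
  then show ?thesis using sums_add[OF summable_sums[OF s0] summable_sums[OF s1]] by simp
qed

subsection \<open>Poisson summation for the Gaussian\<close>

text \<open>For x in [0, 1] the arguments n + x and x - (n + 1) sweep out [n, n + 1] and
  [-(n + 1), -n], and the cosine has period 1. Hence the partial sums are integrals over [-N, N],
  which tend to the Fourier integral over the whole line.\<close>

lemma gaussian_periodization_cos_coeff:
  assumes t: "t > 0"
  shows "(\<lambda>n. integral {0..1} (\<lambda>x. (exp (- pi * (real n + x)\<^sup>2 * t) + exp (- pi * (real n + 1 - x)\<^sup>2 * t))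
            * cos (2 * pi * real k * x))) sums (exp (- pi * (real k)\<^sup>2 * (1 / t)) / sqrt t)"
proof -
  define g where "g x = exp (- pi * x\<^sup>2 * t) * cos (2 * pi * real k * x)" for x
  have cont: "continuous_on S g" for S unfolding g_def by (intro continuous_intros)
  have intg: "g integrable_on {a..b}" for a b by (intro integrable_continuous_interval cont)
  have per: "cos (2 * pi * real k * (x + real n)) = cos (2 * pi * real k * x)" for x n
  proof -
    have "2 * pi * real k * (x + real n) = 2 * pi * real k * x + 2 * pi * of_int (int (k * n))"
      by (simp add: algebra_simps)
    then show ?thesis by (simp only: cos_add cos_int_2pin sin_int_2pin)
  qed
  have even: "g (- x) = g x" for x by (simp add: g_def)
  have right: "integral {0..1} (\<lambda>x. exp (- pi * (real n + x)\<^sup>2 * t) * cos (2 * pi * real k * x))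
      = integral {real n..real (Suc n)} g" for n
  proof -
    have "integral {real n..real (Suc n)} g = integral {0..1} (\<lambda>x. g (x + real n))"
      using integral_shift[where f=g and a=0 and b=1 and c="real n"] cont by (simp add: o_def add.commute)
    then show ?thesis by (simp add: g_def per add.commute)
  qed
  have left: "integral {0..1} (\<lambda>x. exp (- pi * (real n + 1 - x)\<^sup>2 * t) * cos (2 * pi * real k * x))
      = integral {- real (Suc n)..- real n} g" for n
  proof -
    have "integral {- real (Suc n)..- real n} g = integral {0..1} (\<lambda>x. g (x + - real (Suc n)))"
      using integral_shift[where f=g and a=0 and b=1 and c="- real (Suc n)"] cont by (simp add: o_def add.commute)
    moreover have "g (x + - real (Suc n)) = exp (- pi * (real n + 1 - x)\<^sup>2 * t) * cos (2 * pi * real k * x)" for x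
    proof -
      have "(x + - real (Suc n))\<^sup>2 = (real n + 1 - x)\<^sup>2" by (simp add: power2_eq_square algebra_simps)
      then show ?thesis using per[of "x + - real (Suc n)" "Suc n"] by (simp add: g_def)
    qed
    ultimately show ?thesis by simp
  qed
  have partial: "(\<Sum>n<N. integral {0..1} (\<lambda>x. (exp (- pi * (real n + x)\<^sup>2 * t) + exp (- pi * (real n + 1 - x)\<^sup>2 * t))
            * cos (2 * pi * real k * x))) = integral {- real N..real N} g" for N
  proof (induction N)
    case (Suc N)
    have "integral {0..1} (\<lambda>x. (exp (- pi * (real N + x)\<^sup>2 * t) + exp (- pi * (real N + 1 - x)\<^sup>2 * t))
            * cos (2 * pi * real k * x)) = integral {real N..real (Suc N)} g + integral {- real (Suc N)..- real N} g"
      unfolding distrib_right right[symmetric] left[symmetric]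
      by (intro integral_add integrable_continuous_interval continuous_intros)
    moreover have "integral {- real (Suc N)..real (Suc N)} g
       = integral {- real (Suc N)..- real N} g + integral {- real N..real N} g + integral {real N..real (Suc N)} g"
      using Henstock_Kurzweil_Integration.integral_combine[OF _ _ intg[of "- real (Suc N)" "real (Suc N)"], of "real N"]
        Henstock_Kurzweil_Integration.integral_combine[OF _ _ intg[of "- real (Suc N)" "real N"], of "- real N"] by simp
    ultimately show ?case using Suc by simp
  qed simp
  have G: "integrable lborel g" unfolding g_def by (rule gaussian_fourier[OF t])
  \<comment> \<open>Dominated convergence for the truncations to [-N, N], with the norm of
    \<open>g\<close> itself as majorant.\<close>
  have "(\<lambda>N. LBINT x. indicator {- real N..real N} x *\<^sub>R g x) \<longlonglongrightarrow> (LBINT x. g x)"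
  proof (rule integral_dominated_convergence[where w="\<lambda>x. norm (g x)"])
    show "AE x in lborel. (\<lambda>N. indicator {- real N..real N} x *\<^sub>R g x) \<longlonglongrightarrow> g x"
    proof (intro AE_I2 tendsto_eventually)
      fix x :: real
      obtain N0 :: nat where N0: "\<bar>x\<bar> \<le> real N0" using real_arch_simple by blast
      show "\<forall>\<^sub>F N in sequentially. indicator {- real N..real N} x *\<^sub>R g x = g x"
        using eventually_ge_at_top[of N0] by eventually_elim (use N0 in \<open>auto simp: indicator_def\<close>)
    qed
  qed (use G in \<open>auto simp: indicator_def\<close>)
  moreover have "(LBINT x. indicator {- real N..real N} x *\<^sub>R g x) = integral {- real N..real N} g" for N
    using borel_integrable_atLeastAtMost'[OF cont, of "- real N" "real N"]
    by (subst set_borel_integral_eq_integral(2)[symmetric]) (auto simp: set_lebesgue_integral_def)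
  ultimately show ?thesis
    using gaussian_fourier(2)[OF t, of "real k"] unfolding sums_def partial by (simp add: g_def)
qed

text \<open>By orthogonality only the indices j = k and j + 1 = k contribute. For k > 0 each gives
  half of \<open>a k\<close>; for k = 0 the constant term alone gives all of
  \<open>a 0\<close>.\<close>

lemma gaussian_series_cos_coeff:
  assumes t: "t > 0"
  defines "a \<equiv> \<lambda>j::nat. exp (- pi * (real j)\<^sup>2 * t)"
  shows "(\<lambda>j. integral {0..1} (\<lambda>x. (a j * cos (2 * pi * real j * x) + a (Suc j) * cos (2 * pi * real (Suc j) * x))
            * cos (2 * pi * real k * x))) sums a k"
proof -
  have "integral {0..1} (\<lambda>x. (a j * cos (2 * pi * real j * x) + a (Suc j) * cos (2 * pi * real (Suc j) * x))
            * cos (2 * pi * real k * x))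
      = a j * integral {0..1} (\<lambda>x. cos (2 * pi * real j * x) * cos (2 * pi * real k * x))
        + a (Suc j) * integral {0..1} (\<lambda>x. cos (2 * pi * real (Suc j) * x) * cos (2 * pi * real k * x))" for j
    unfolding distrib_right mult.assoc[of "a j"] mult.assoc[of "a (Suc j)"] integral_mult_right[symmetric]
    by (intro integral_add integrable_continuous_interval continuous_intros)
  then have eq: "integral {0..1} (\<lambda>x. (a j * cos (2 * pi * real j * x) + a (Suc j) * cos (2 * pi * real (Suc j) * x))
            * cos (2 * pi * real k * x))
      = (if j = k then a k * (if k = 0 then 1 else 1 / 2) else 0) + (if j = k - 1 then if k = 0 then 0 else a k / 2 else 0)" for j
    unfolding integral_cos_cos by (cases k) auto
  show ?thesis
    unfolding eq using sums_add[OF sums_single[of k "\<lambda>_. a k * (if k = 0 then 1 else 1 / 2)"]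
      sums_single[of "k - 1" "\<lambda>_. if k = 0 then 0 else a k / 2"]]
    by (cases "k = 0") (simp_all cong: if_cong)
qed

theorem theta_inversion:
  assumes t: "t > 0"
  shows "theta (1 / t) = sqrt t * theta t"
proof -
  \<comment> \<open>\<open>f n\<close> pairs the translates by n and -(n + 1), and the symmetry x to
    1 - x exchanges its two terms.\<close>
  define f where "f n x = exp (- pi * (real n + x)\<^sup>2 * t) + exp (- pi * (real n + 1 - x)\<^sup>2 * t)" for n x
  define a where "a j = exp (- pi * (real j)\<^sup>2 * (1 / t))" for j :: nat
  define g where "g j x = a j * cos (2 * pi * real j * x) + a (Suc j) * cos (2 * pi * real (Suc j) * x)" for j x
  define D where "D x = (\<Sum>n. f n x) - (\<Sum>j. g j x) * (1 / sqrt t)" for x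
  have fb: "\<bar>f n x\<bar> \<le> 2 * exp (- pi * (real n)\<^sup>2 * t)" if "x \<in> {0..1}" for n x
  proof -
    have "(real n)\<^sup>2 \<le> (real n + x)\<^sup>2" "(real n)\<^sup>2 \<le> (real n + 1 - x)\<^sup>2" using that by (auto intro!: power_mono)
    then have "exp (- pi * (real n + x)\<^sup>2 * t) \<le> exp (- pi * (real n)\<^sup>2 * t)"
      "exp (- pi * (real n + 1 - x)\<^sup>2 * t) \<le> exp (- pi * (real n)\<^sup>2 * t)" using t by (auto intro!: mult_right_mono)
    from add_mono[OF this] show ?thesis
      by (simp only: f_def abs_of_nonneg add_nonneg_nonneg exp_ge_zero mult_2)
  qed
  have fs: "summable (\<lambda>n. 2 * exp (- pi * (real n)\<^sup>2 * t))" by (intro summable_mult summable_gaussian t)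
  have as: "summable a" unfolding a_def using t by (intro summable_gaussian) auto
  have gb: "\<bar>g j x\<bar> \<le> a j + a (Suc j)" for j x
    unfolding g_def by (rule order_trans[OF abs_triangle_ineq]) (auto simp: a_def abs_mult intro!: add_mono mult_left_le)
  have gs: "summable (\<lambda>j. a j + a (Suc j))" using as by (intro summable_add) (auto simp: summable_Suc_iff)
  have fc: "continuous_on {0..1} (f n)" for n unfolding f_def by (intro continuous_intros)
  have gc: "continuous_on {0..1} (g n)" for n unfolding g_def by (intro continuous_intros)
  \<comment> \<open>Both expansions have the cosine coefficients \<open>a k / sqrt t\<close>. At x =
    0 the series of \<open>f\<close> and \<open>g\<close> become those of \<open>theta_sums\<close>
    for \<open>t\<close> and \<open>1 / t\<close>.\<close>
  have "D 0 = 0"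
  proof (rule eq_0_if_cos_coeffs_0[where D = D])
    show "continuous_on {0..1} D" unfolding D_def
      by (intro continuous_intros uniform_series_continuous[OF fc fb fs] uniform_series_continuous[OF gc gb gs])
  next
    fix x :: real assume "x \<in> {0..1}"
    have "f n (1 - x) = f n x" for n by (simp add: f_def algebra_simps)
    moreover have "cos (2 * pi * real m * (1 - x)) = cos (2 * pi * real m * x)" for m
    proof -
      have "2 * pi * real m * (1 - x) = 2 * pi * of_int (int m) - 2 * pi * real m * x" by (simp add: algebra_simps)
      then show ?thesis by (simp only: cos_diff cos_int_2pin sin_int_2pin mult_zero_left mult_1_left add_0_right)
    qed
    then have "g j (1 - x) = g j x" for j by (simp only: g_def)
    ultimately show "D (1 - x) = D x" by (simp add: D_def)
  next
    fix k :: nat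
    have "((\<lambda>x. (\<Sum>n. f n x) * cos (2 * pi * real k * x)) has_integral (a k / sqrt t)) {0..1}"
      by (rule uniform_series_cos_coeff[OF fc fb fs])
        (use gaussian_periodization_cos_coeff[OF t, of k] in \<open>auto simp: f_def a_def\<close>)
    moreover have "((\<lambda>x. (\<Sum>n. g n x) * cos (2 * pi * real k * x)) has_integral a k) {0..1}"
      by (rule uniform_series_cos_coeff[OF gc gb gs])
        (use gaussian_series_cos_coeff[of "1 / t" k] t in \<open>auto simp: g_def a_def\<close>)
    ultimately have "((\<lambda>x. (\<Sum>n. f n x) * cos (2 * pi * real k * x) -
        (\<Sum>n. g n x) * cos (2 * pi * real k * x) * (1 / sqrt t)) has_integral (a k / sqrt t - a k * (1 / sqrt t))) {0..1}"
      by (intro has_integral_diff has_integral_mult_left)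
    then show "((\<lambda>x. D x * cos (2 * pi * real k * x)) has_integral 0) {0..1}"
      by (simp add: D_def algebra_simps)
  qed simp
  moreover have "(\<Sum>n. f n 0) = theta t"
    using theta_sums[OF t] by (simp add: sums_iff f_def add.commute)
  moreover have "(\<Sum>n. g n 0) = theta (1 / t)"
    using theta_sums[of "1 / t"] t by (simp add: sums_iff g_def a_def)
  ultimately show ?thesis using t by (simp add: D_def field_simps)
qed

subsection \<open>The logarithm of the theta function\<close>

lemma theta_ge_1: "t > 0 \<Longrightarrow> theta t \<ge> 1"
proof -
  assume t: "t > 0"
  let ?f = "\<lambda>n::nat. exp (- pi * (real n)\<^sup>2 * t) + exp (- pi * (real (Suc n))\<^sup>2 * t)"
  have "sum ?f {..<1} \<le> suminf ?f"
    by (rule sum_le_suminf) (use theta_sums[OF t] in \<open>auto simp: sums_iff intro: add_nonneg_nonneg\<close>)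
  moreover have "sum ?f {..<1} \<ge> 1" by simp
  moreover have "suminf ?f = theta t" using theta_sums[OF t] by (simp only: sums_iff)
  ultimately show ?thesis by linarith
qed

text \<open>Since pi n^2 >= n, the series is dominated by a geometric one with ratio q = exp(-t).
  The crude rate exp(-t) suffices for the doubly exponential decay of
  \<open>log_theta\<close>.\<close>

lemma theta_le:
  assumes t: "t \<ge> 1"
  shows "theta t \<le> 1 + 4 * exp (- t)"
proof -
  define q where "q = exp (- t)"
  have "q \<le> exp (- 1)" using t by (simp add: q_def)
  also have "exp (- 1) \<le> (1 / 2 :: real)" using exp_ge_add_one_self[of "1::real"] by (simp add: exp_minus field_simps)
  finally have q: "0 < q" "q \<le> 1 / 2" by (simp_all add: q_def)
  have le: "exp (- pi * (real n)\<^sup>2 * t) \<le> q ^ n" for n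
  proof -
    have "real n \<le> (real n)\<^sup>2" by (cases n) (auto simp: power2_eq_square)
    moreover have "1 * (real n)\<^sup>2 \<le> pi * (real n)\<^sup>2" using pi_gt3 by (intro mult_right_mono) auto
    ultimately have "real n * t \<le> pi * (real n)\<^sup>2 * t" using t by (intro mult_right_mono) linarith+
    then show ?thesis by (simp add: q_def exp_of_nat_mult[symmetric])
  qed
  have "(\<lambda>n. q ^ n + q ^ n * q) sums (1 / (1 - q) + 1 / (1 - q) * q)"
    using q by (intro sums_add sums_mult2 geometric_sums) auto
  moreover have "exp (- pi * (real n)\<^sup>2 * t) + exp (- pi * (real (Suc n))\<^sup>2 * t) \<le> q ^ n + q ^ n * q" for n
    using add_mono[OF le[of n] le[of "Suc n"]] by (simp only: power_Suc2)
  moreover have "t > 0" using t by simp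
  ultimately have "theta t \<le> 1 / (1 - q) + 1 / (1 - q) * q"
    by (intro sums_le[OF _ theta_sums])
  \<comment> \<open>(1 + q)/(1 - q) = 1 + 2q/(1 - q), and q \<le> 1/2 bounds the fraction by
    4q.\<close>
  also have "\<dots> \<le> 1 + 4 * q" using q mult_left_mono[of q "1/2" q] by (simp add: field_simps)
  finally show ?thesis by (simp add: q_def)
qed

lemma isCont_theta:
  assumes "t > 0"
  shows "isCont theta t"
proof -
  \<comment> \<open>On [t/2, \<infinity>) the series is dominated by its value at t/2, and t is an
    interior point of this half-line.\<close>
  define a where "a = t / 2"
  have a: "a > 0" using assms by (simp add: a_def)
  let ?f = "\<lambda>(n::nat) t. exp (- pi * (real n)\<^sup>2 * t) + exp (- pi * (real (Suc n))\<^sup>2 * t)"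
  have "continuous_on {a..} (\<lambda>t. \<Sum>n. ?f n t)"
  proof (rule uniform_series_continuous)
    show "summable (\<lambda>n. ?f n a)" using theta_sums[OF a] by (simp add: sums_iff)
    show "\<bar>?f n t\<bar> \<le> ?f n a" if "t \<in> {a..}" for n t
    proof -
      have "exp (- pi * (real m)\<^sup>2 * t) \<le> exp (- pi * (real m)\<^sup>2 * a)" for m
        using that by (auto intro!: mult_left_mono)
      from add_mono[OF this[of n] this[of "Suc n"]] show ?thesis by (simp only: abs_of_nonneg add_nonneg_nonneg exp_ge_zero)
    qed
  qed (intro continuous_intros)
  moreover have "(\<Sum>n. ?f n t) = theta t" if "t \<in> {a..}" for t
    using theta_sums[of t] that a by (simp add: sums_iff)
  ultimately have "continuous_on {a..} theta" by (rule continuous_on_eq)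
  then show ?thesis
    by (rule continuous_on_interior) (use assms in \<open>auto simp: a_def interior_real_atLeast\<close>)
qed

definition log_theta :: "real \<Rightarrow> real" where
  "log_theta x = ln (theta (exp (2 * x)))"

lemma log_theta_nonneg: "log_theta x \<ge> 0"
  using theta_ge_1[of "exp (2 * x)"] by (simp add: log_theta_def)

lemma continuous_on_log_theta [continuous_intros]: "continuous_on S f \<Longrightarrow> continuous_on S (\<lambda>x. log_theta (f x))"
proof -
  have "isCont log_theta x" for x unfolding log_theta_def
    using theta_ge_1[of "exp (2 * x)"] by (intro continuous_intros isCont_o2[OF _ isCont_theta]) auto
  then have "continuous_on UNIV log_theta" by (simp add: continuous_at_imp_continuous_on)
  then show "continuous_on S f \<Longrightarrow> continuous_on S (\<lambda>x. log_theta (f x))" by (rule continuous_on_compose2) auto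
qed

lemma theta_powr: "complex_of_real (theta (exp (2 * x))) powr w = exp (w * of_real (log_theta x))"
  using theta_ge_1[of "exp (2 * x)"] by (simp add: log_theta_def powr_def Ln_of_real mult.commute)

lemma log_theta_minus: "log_theta (- x) = log_theta x + x"
proof -
  have "exp (2 * - x) = 1 / exp (2 * x)" by (simp add: exp_minus field_simps)
  moreover have "sqrt (exp (2 * x)) = exp x" by (rule real_sqrt_unique) (auto simp: exp_double)
  ultimately have "theta (exp (2 * - x)) = exp x * theta (exp (2 * x))"
    using theta_inversion[of "exp (2 * x)"] by simp
  then show ?thesis using theta_ge_1[of "exp (2 * x)"] by (simp add: log_theta_def ln_mult)
qed

text \<open>From ln y \<le> y - 1 the left side is at most 4 exp(a x - exp(2x)). As x^2 \<le>
  exp(2x), completing the square in (a + 1) x - x^2 gives the constant and leaves an integrable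
  exp(-x).\<close>

lemma log_theta_decay:
  assumes x: "x \<ge> 0"
  shows "log_theta x * exp (a * x) \<le> 4 * exp ((a + 1)\<^sup>2 / 4) * exp (- x)"
proof -
  have "log_theta x \<le> theta (exp (2 * x)) - 1"
    unfolding log_theta_def using theta_ge_1[of "exp (2 * x)"] by (intro ln_le_minus_one) auto
  also have "\<dots> \<le> 4 * exp (- exp (2 * x))" using theta_le[of "exp (2 * x)"] x by simp
  finally have "log_theta x * exp (a * x) \<le> 4 * exp (- exp (2 * x)) * exp (a * x)" by (intro mult_right_mono) auto
  also have "\<dots> = 4 * exp (a * x - exp (2 * x))" by (simp add: exp_diff exp_minus field_simps)
  also have "\<dots> \<le> 4 * exp ((a + 1)\<^sup>2 / 4 + - x)"
  proof -
    have "1 + 2 * x + 2 * x\<^sup>2 \<le> exp (2 * x)"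
      using x exp_lower_Taylor_quadratic[of "2 * x"] by (simp add: power_mult_distrib)
    moreover have "0 \<le> x\<^sup>2" by simp
    ultimately have "x\<^sup>2 \<le> exp (2 * x)" using x by linarith
    moreover have "a * x + x \<le> (a + 1)\<^sup>2 / 4 + x\<^sup>2"
      using zero_le_power2[of "(a + 1) / 2 - x"] by (simp add: power2_eq_square field_simps)
    ultimately have "a * x - exp (2 * x) \<le> (a + 1)\<^sup>2 / 4 - x" by linarith
    then show ?thesis by simp
  qed
  finally show ?thesis by (simp only: exp_add mult.assoc)
qed

lemma set_integrable_exp_neg:
  assumes "a < (0::real)"
  shows "set_integrable lborel {0..} (\<lambda>x. exp (a * x))"
proof -
  have "(\<lambda>x. exp (a * x)) integrable_on {0..}"
    using has_integral_exp_minus_to_infinity[of "- a" 0] assms by (auto simp: integrable_on_def)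
  \<comment> \<open>Nonnegativity gives absolute integrability for the completed measure; Borel
    measurability brings it back to \<open>lborel\<close>.\<close>
  then have "(\<lambda>x. exp (a * x)) absolutely_integrable_on {0..}"
    by (intro nonnegative_absolutely_integrable_1) auto
  moreover have "(\<lambda>x. indicator {0..} x *\<^sub>R exp (a * x)) \<in> borel_measurable lborel" by simp
  ultimately show ?thesis unfolding set_integrable_def by (simp add: integrable_completion)
qed

text \<open>By \<open>log_theta_decay\<close> one factor \<open>log_theta x\<close> outweighs
  exponential growth of any rate \<open>a\<close>. The integrability claims for
  \<open>theta_tail\<close> and its derivatives reduce to this.\<close>

lemma set_integrable_log_theta_bound:
  fixes f :: "real \<Rightarrow> complex"
  assumes cont: "continuous_on UNIV f"
    and bound: "\<And>x. x \<ge> 0 \<Longrightarrow> norm (f x) \<le> K * (log_theta x * exp (a * x))" and K: "K \<ge> 0"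
  shows "set_integrable lborel {0..} f"
proof -
  have "set_integrable lborel {0..} (\<lambda>x. K * (4 * exp ((a + 1)\<^sup>2 / 4)) * exp ((-1) * x))"
    by (intro set_integrable_mult_right set_integrable_exp_neg) auto
  moreover have "f \<in> borel_measurable borel" by (rule borel_measurable_continuous_onI[OF cont])
  then have "set_borel_measurable lborel {0..} f" unfolding set_borel_measurable_def by simp
  moreover have "norm (f x) \<le> norm (K * (4 * exp ((a + 1)\<^sup>2 / 4)) * exp ((-1) * x))" if "x \<ge> 0" for x
    using order_trans[OF bound[OF that] mult_left_mono[OF log_theta_decay[OF that, of a] K]] K
    by (simp add: abs_mult mult_ac)
  ultimately show ?thesis
    unfolding set_integrable_def set_borel_measurable_def
    by - (erule (1) Bochner_Integration.integrable_bound, auto simp: indicator_def)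
qed

subsection \<open>The entire part of the integral\<close>

lemma norm_exp_sub_1: "norm (exp z - 1) \<le> norm z * exp (norm z)" for z :: complex
  using Taylor_exp_field[of z 0] by (simp add: mult.commute)

lemma norm_exp_sub_1_sub: "norm (exp z - 1 - z) \<le> (norm z)\<^sup>2 * exp (norm z)" for z :: complex
  using Taylor_exp_field[of z 1] by (simp add: diff_diff_eq numeral_2_eq_2 mult.commute)

text \<open>The function \<open>A(w, s)\<close> of the introduction. Subtracting 1, the limit of the
  theta power at infinity, makes the integral converge for every \<open>s\<close>.\<close>

definition theta_tail :: "complex \<Rightarrow> complex \<Rightarrow> complex" where
  "theta_tail w s = (LINT x:{0..}|lborel. (exp (w * complex_of_real (log_theta x)) - 1) * exp (s * complex_of_real x))"

lemma norm_exp_mult_of_real: "norm (exp (z * complex_of_real x)) \<le> exp (norm z * x)" if "x \<ge> 0" for z :: complex and x :: real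
  using that complex_Re_le_cmod[of z] by (auto intro!: mult_right_mono)

text \<open>The constant is that of \<open>log_theta_decay\<close> at \<open>a = 0\<close>; it
  recurs below as \<open>B\<close>.\<close>

lemma log_theta_bounded: "x \<ge> 0 \<Longrightarrow> log_theta x \<le> 4 * exp (1 / 4)"
  by (rule order_trans[OF log_theta_decay[of x 0, simplified] mult_left_le]) auto

lemma norm_exp_mult_log_theta: "norm (exp (z * complex_of_real (log_theta x))) \<le> exp (norm z * (4 * exp (1 / 4)))" if "x \<ge> 0" for z :: complex
proof -
  have "norm (exp (z * complex_of_real (log_theta x))) \<le> exp (norm z * log_theta x)"
    by (rule norm_exp_mult_of_real[OF log_theta_nonneg])
  also have "\<dots> \<le> exp (norm z * (4 * exp (1 / 4)))" using log_theta_bounded[OF that] by (auto intro: mult_left_mono)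
  finally show ?thesis .
qed

text \<open>Only the exponential factor is bounded by a constant; the linear factor
  \<open>log_theta x\<close> is kept because it carries the decay.\<close>

lemma norm_theta_powr_sub_1:
  assumes "x \<ge> 0"
  shows "norm (exp (w * complex_of_real (log_theta x)) - 1) \<le> norm w * exp (norm w * (4 * exp (1 / 4))) * log_theta x"
proof -
  have "norm (exp (w * complex_of_real (log_theta x)) - 1) \<le> norm w * log_theta x * exp (norm w * log_theta x)"
    using norm_exp_sub_1[of "w * complex_of_real (log_theta x)"] log_theta_nonneg[of x] by (simp add: norm_mult)
  also have "\<dots> \<le> norm w * log_theta x * exp (norm w * (4 * exp (1 / 4)))"
    using log_theta_bounded[OF assms] log_theta_nonneg[of x] by (intro mult_left_mono) (auto intro: mult_left_mono)
  finally show ?thesis by (simp add: mult_ac)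
qed

lemma theta_tail_integrable:
  "set_integrable lborel {0..} (\<lambda>x. (exp (w * complex_of_real (log_theta x)) - 1) * exp (s * complex_of_real x))"
proof (rule set_integrable_log_theta_bound)
  fix x :: real assume x: "x \<ge> 0"
  show "norm ((exp (w * complex_of_real (log_theta x)) - 1) * exp (s * complex_of_real x))
    \<le> norm w * exp (norm w * (4 * exp (1 / 4))) * (log_theta x * exp (norm s * x))"
    using mult_mono[OF norm_theta_powr_sub_1[OF x, of w] norm_exp_mult_of_real[OF x, of s]] log_theta_nonneg[of x]
    by (simp only: norm_mult mult.assoc) (simp add: mult_ac)
qed (auto intro!: continuous_intros)

text \<open>This is the derivative in \<open>w\<close> of the integrand of
  \<open>theta_tail\<close>; its integral becomes the coefficient \<open>a\<close> in
  \<open>theta_tail_has_derivative\<close>.\<close>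

lemma theta_tail_integrable_dw:
  "set_integrable lborel {0..} (\<lambda>x. complex_of_real (log_theta x) * exp (w * complex_of_real (log_theta x)) * exp (s * complex_of_real x))"
proof (rule set_integrable_log_theta_bound)
  fix x :: real assume x: "x \<ge> 0"
  have "norm (exp (w * complex_of_real (log_theta x)) * exp (s * complex_of_real x)) \<le> exp (norm w * (4 * exp (1 / 4))) * exp (norm s * x)"
    unfolding norm_mult by (intro mult_mono norm_exp_mult_log_theta norm_exp_mult_of_real x) auto
  from mult_left_mono[OF this log_theta_nonneg]
  show "norm (complex_of_real (log_theta x) * exp (w * complex_of_real (log_theta x)) * exp (s * complex_of_real x))
    \<le> exp (norm w * (4 * exp (1 / 4))) * (log_theta x * exp (norm s * x))"
    unfolding norm_mult norm_of_real abs_of_nonneg[OF log_theta_nonneg] by (simp only: mult_ac)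
qed (auto intro!: continuous_intros)

text \<open>The derivative in \<open>s\<close>, giving the coefficient \<open>b\<close>. The factor
  x is absorbed by exp(x), which raises the rate to \<open>norm s + 1\<close>.\<close>

lemma theta_tail_integrable_ds:
  "set_integrable lborel {0..} (\<lambda>x. complex_of_real x * (exp (w * complex_of_real (log_theta x)) - 1) * exp (s * complex_of_real x))"
proof (rule set_integrable_log_theta_bound)
  fix x :: real assume x: "x \<ge> 0"
  have "x \<le> exp x" using exp_ge_add_one_self[of x] by linarith
  then have "x * norm ((exp (w * complex_of_real (log_theta x)) - 1)) * norm (exp (s * complex_of_real x))
    \<le> exp x * (norm w * exp (norm w * (4 * exp (1 / 4))) * log_theta x) * exp (norm s * x)"
    using norm_theta_powr_sub_1[OF x, of w] norm_exp_mult_of_real[OF x, of s] x log_theta_nonneg[of x]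
    by (intro mult_mono) auto
  also have "\<dots> = norm w * exp (norm w * (4 * exp (1 / 4))) * (log_theta x * (exp x * exp (norm s * x)))" by (simp only: mult_ac)
  also have "exp x * exp (norm s * x) = exp ((norm s + 1) * x)" by (simp add: exp_add[symmetric] algebra_simps)
  finally show "norm (complex_of_real x * (exp (w * complex_of_real (log_theta x)) - 1) * exp (s * complex_of_real x))
    \<le> norm w * exp (norm w * (4 * exp (1 / 4))) * (log_theta x * exp ((norm s + 1) * x))"
    using x by (simp only: norm_mult norm_of_real abs_of_nonneg)
qed (auto intro!: continuous_intros)

text \<open>The first-order Taylor remainder of the integrand is quadratic in (h, k), with an
  integrable weight in x. The 2 in \<open>norm s + 2\<close> collects two factors exp(x): one from
  exp(k x) with |k| \<le> 1, one from bounding a power of x.\<close>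

lemma theta_tail_remainder:
  fixes w s h k :: complex and x :: real
  assumes x: "x \<ge> 0" and h: "norm h \<le> 1" and k: "norm k \<le> 1"
  defines "l \<equiv> complex_of_real (log_theta x)" and "B \<equiv> 4 * exp (1 / 4) :: real"
  shows "norm ((exp ((w + h) * l) - 1) * exp ((s + k) * complex_of_real x) - (exp (w * l) - 1) * exp (s * complex_of_real x)
      - (h * (l * exp (w * l) * exp (s * complex_of_real x)) + k * (complex_of_real x * (exp (w * l) - 1) * exp (s * complex_of_real x))))
    \<le> (norm (h, k))\<^sup>2 * (exp (norm w * B) * (2 * norm w + B * exp B + 1)) * (log_theta x * exp ((norm s + 2) * x))"
    (is "norm ?R \<le> _")
proof -
  define E where "E = exp (norm w * B)"
  have E: "E > 0" "E \<ge> 1" by (auto simp: E_def B_def)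
  have B: "B > 0" by (simp add: B_def)
  let ?L = "log_theta x"
  have L: "0 \<le> ?L" "?L \<le> B" using log_theta_nonneg log_theta_bounded[OF x] by (auto simp: B_def)
  have nl: "norm l = ?L" using L by (simp add: l_def)
  \<comment> \<open>Grouped so that each summand has one of the decaying factors \<open>exp (w l) - 1\<close>, \<open>exp (h l) - 1 - h l\<close>, \<open>l\<close>.\<close>
  have R: "?R = exp (s * complex_of_real x) * ((exp (w * l) - 1) * (exp (k * complex_of_real x) - 1 - k * complex_of_real x)
      + exp (w * l) * (exp (k * complex_of_real x) * (exp (h * l) - 1 - h * l) + h * l * (exp (k * complex_of_real x) - 1)))"
    by (simp add: distrib_right exp_add) (simp add: algebra_simps)
  have ex: "x \<le> exp x" "x\<^sup>2 \<le> 2 * exp x" "exp x \<le> exp (2 * x)" "1 \<le> exp x"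
    using exp_ge_add_one_self[of x] exp_lower_Taylor_quadratic[OF x] x by (linarith, linarith, auto)
  have e2: "exp x * exp x = exp (2 * x)" by (simp add: exp_double power2_eq_square)
  have kx: "norm k * x \<le> x" using mult_right_mono[OF k x] by simp
  have hL: "norm h * ?L \<le> B" using mult_mono[OF h L(2)] L by simp
  have 1: "norm (exp (k * complex_of_real x) - 1 - k * complex_of_real x) \<le> (norm k)\<^sup>2 * (2 * exp (2 * x))"
  proof -
    have "norm (exp (k * complex_of_real x) - 1 - k * complex_of_real x) \<le> (norm k * x)\<^sup>2 * exp (norm k * x)"
      using norm_exp_sub_1_sub[of "k * complex_of_real x"] x by (simp add: norm_mult)
    also have "\<dots> \<le> (norm k * x)\<^sup>2 * exp x" using kx by (intro mult_left_mono) auto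
    also have "\<dots> = (norm k)\<^sup>2 * (x\<^sup>2 * exp x)" by (simp add: power_mult_distrib)
    also have "\<dots> \<le> (norm k)\<^sup>2 * ((2 * exp x) * exp x)" using ex by (intro mult_left_mono mult_right_mono) auto
    finally show ?thesis by (simp only: e2 mult.assoc)
  qed
  have 2: "norm (exp (h * l) - 1 - h * l) \<le> (norm h)\<^sup>2 * (B * exp B * ?L)"
  proof -
    have "norm (exp (h * l) - 1 - h * l) \<le> (norm h * ?L)\<^sup>2 * exp (norm h * ?L)"
      using norm_exp_sub_1_sub[of "h * l"] by (simp add: norm_mult nl)
    also have "\<dots> \<le> (norm h * ?L)\<^sup>2 * exp B" using hL by (intro mult_left_mono) auto
    also have "\<dots> = (norm h)\<^sup>2 * ((?L * ?L) * exp B)" by (simp add: power_mult_distrib power2_eq_square)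
    also have "\<dots> \<le> (norm h)\<^sup>2 * ((B * ?L) * exp B)" using L by (intro mult_left_mono mult_right_mono) auto
    finally show ?thesis by (simp add: mult_ac)
  qed
  have 3: "norm (exp (k * complex_of_real x) - 1) \<le> norm k * exp (2 * x)"
  proof -
    have "norm (exp (k * complex_of_real x) - 1) \<le> norm k * x * exp (norm k * x)"
      using norm_exp_sub_1[of "k * complex_of_real x"] x by (simp add: norm_mult)
    also have "\<dots> \<le> norm k * exp x * exp x" using kx ex x by (intro mult_mono) auto
    finally show ?thesis by (simp only: e2 mult.assoc)
  qed
  have 4: "norm (exp (k * complex_of_real x)) \<le> exp (2 * x)"
    using norm_exp_mult_of_real[OF x, of k] kx ex by (meson exp_le_cancel_iff order_trans)
  have hk: "(norm h)\<^sup>2 + (norm k)\<^sup>2 = (norm (h, k))\<^sup>2" by (simp add: norm_Pair)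
  have hk1: "(norm k)\<^sup>2 \<le> (norm (h, k))\<^sup>2" "(norm h)\<^sup>2 \<le> (norm (h, k))\<^sup>2" unfolding hk[symmetric] by auto
  have hk2: "norm h * norm k \<le> (norm (h, k))\<^sup>2"
    unfolding hk[symmetric] using sum_squares_bound[of "norm h" "norm k"] mult_nonneg_nonneg[OF norm_ge_zero[of h] norm_ge_zero[of k]]
    by linarith
  let ?N = "(norm (h, k))\<^sup>2"
  have "norm ((exp (w * l) - 1) * (exp (k * complex_of_real x) - 1 - k * complex_of_real x))
      \<le> (norm w * E * ?L) * (?N * (2 * exp (2 * x)))"
    unfolding norm_mult
  proof (rule mult_mono)
    show "norm (exp (w * l) - 1) \<le> norm w * E * ?L" using norm_theta_powr_sub_1[OF x, of w] by (simp add: E_def B_def l_def)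
    show "norm (exp (k * complex_of_real x) - 1 - k * complex_of_real x) \<le> ?N * (2 * exp (2 * x))"
      by (rule order_trans[OF 1 mult_right_mono[OF hk1(1)]]) auto
  qed (use E L in auto)
  moreover have "norm (exp (w * l) * (exp (k * complex_of_real x) * (exp (h * l) - 1 - h * l) + h * l * (exp (k * complex_of_real x) - 1)))
     \<le> E * (exp (2 * x) * (?N * (B * exp B * ?L)) + ?N * ?L * exp (2 * x))"
    unfolding norm_mult[of "exp (w * l)"]
  proof (rule mult_mono)
    show "norm (exp (w * l)) \<le> E" using norm_exp_mult_log_theta[OF x, of w] by (simp add: E_def B_def l_def)
    have "norm (exp (k * complex_of_real x) * (exp (h * l) - 1 - h * l)) \<le> exp (2 * x) * (?N * (B * exp B * ?L))"
      unfolding norm_mult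
    proof (rule mult_mono[OF 4])
      show "norm (exp (h * l) - 1 - h * l) \<le> ?N * (B * exp B * ?L)"
        by (rule order_trans[OF 2 mult_right_mono[OF hk1(2)]]) (use B L in auto)
    qed auto
    moreover have "norm (h * l * (exp (k * complex_of_real x) - 1)) \<le> ?N * ?L * exp (2 * x)"
    proof -
      have "norm (h * l * (exp (k * complex_of_real x) - 1)) = norm h * ?L * norm (exp (k * complex_of_real x) - 1)" by (simp add: norm_mult nl)
      also have "\<dots> \<le> norm h * ?L * (norm k * exp (2 * x))" using 3 L by (intro mult_left_mono) auto
      also have "\<dots> = norm h * norm k * (?L * exp (2 * x))" by (simp add: mult_ac)
      also have "\<dots> \<le> ?N * (?L * exp (2 * x))" using hk2 L by (intro mult_right_mono) auto
      finally show ?thesis by (simp add: mult_ac)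
    qed
    ultimately show "norm (exp (k * complex_of_real x) * (exp (h * l) - 1 - h * l) + h * l * (exp (k * complex_of_real x) - 1))
      \<le> exp (2 * x) * (?N * (B * exp B * ?L)) + ?N * ?L * exp (2 * x)"
      by (rule order_trans[OF norm_triangle_ineq add_mono])
  qed (use E in auto)
  ultimately have "norm ((exp (w * l) - 1) * (exp (k * complex_of_real x) - 1 - k * complex_of_real x)
      + exp (w * l) * (exp (k * complex_of_real x) * (exp (h * l) - 1 - h * l) + h * l * (exp (k * complex_of_real x) - 1)))
    \<le> (norm w * E * ?L) * (?N * (2 * exp (2 * x))) + E * (exp (2 * x) * (?N * (B * exp B * ?L)) + ?N * ?L * exp (2 * x))"
    by (rule order_trans[OF norm_triangle_ineq add_mono])
  also have "\<dots> = ?N * (E * (2 * norm w + B * exp B + 1)) * (?L * exp (2 * x))" by (simp add: algebra_simps)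
  finally have "norm ?R \<le> exp (norm s * x) * (?N * (E * (2 * norm w + B * exp B + 1)) * (?L * exp (2 * x)))"
    unfolding R norm_mult[of "exp (s * complex_of_real x)"]
    by (intro mult_mono norm_exp_mult_of_real[OF x]) auto
  also have "\<dots> = ?N * (E * (2 * norm w + B * exp B + 1)) * (?L * (exp (norm s * x) * exp (2 * x)))" by (simp only: mult_ac)
  also have "exp (norm s * x) * exp (2 * x) = exp ((norm s + 2) * x)" by (simp add: exp_add[symmetric] algebra_simps)
  finally show ?thesis by (simp only: E_def)
qed

text \<open>Differentiation under the integral sign: integrating the pointwise remainder bound
  leaves a multiple of the squared norm of (h, k), which is o(norm).\<close>

lemma theta_tail_has_derivative:
  "\<exists>a b. ((\<lambda>(w, s). theta_tail w s) has_derivative (\<lambda>(h, k). a * h + b * k)) (at (w, s))"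
proof -
  define B where "B = 4 * exp (1 / 4 :: real)"
  define K where "K = exp (norm w * B) * (2 * norm w + B * exp B + 1)"
  have K: "K \<ge> 0" by (auto simp: K_def B_def intro!: mult_nonneg_nonneg add_nonneg_nonneg)
  let ?f = "\<lambda>w s x. (exp (w * complex_of_real (log_theta x)) - 1) * exp (s * complex_of_real x)"
  let ?a = "\<lambda>x. complex_of_real (log_theta x) * exp (w * complex_of_real (log_theta x)) * exp (s * complex_of_real x)"
  let ?b = "\<lambda>x. complex_of_real x * (exp (w * complex_of_real (log_theta x)) - 1) * exp (s * complex_of_real x)"
  let ?g = "\<lambda>x. complex_of_real (log_theta x * exp ((norm s + 2) * x))"
  define a where "a = (LINT x:{0..}|lborel. ?a x)"
  define b where "b = (LINT x:{0..}|lborel. ?b x)"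
  have gint: "set_integrable lborel {0..} ?g"
    by (rule set_integrable_log_theta_bound[of _ 1 "norm s + 2"])
      (auto intro!: continuous_intros simp: norm_mult log_theta_nonneg abs_mult abs_of_nonneg simp del: of_real_mult)
  define M where "M = (LINT x:{0..}|lborel. norm (?g x))"
  have M: "M \<ge> 0" unfolding M_def set_lebesgue_integral_def by (intro integral_nonneg_AE) auto
  have est: "norm (theta_tail (w + h) (s + k) - theta_tail w s - (a * h + b * k)) \<le> K * M * (norm (h, k))\<^sup>2"
    if "norm h \<le> 1" "norm k \<le> 1" for h k
  proof -
    let ?r = "\<lambda>x. ?f (w + h) (s + k) x - ?f w s x - (h * ?a x + k * ?b x)"
    note I1 = theta_tail_integrable[of "w + h" "s + k"] and I2 = theta_tail_integrable[of w s]
    have Ia: "set_integrable lborel {0..} (\<lambda>x. h * ?a x)" and Ib: "set_integrable lborel {0..} (\<lambda>x. k * ?b x)"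
      by (intro set_integrable_mult_right theta_tail_integrable_dw theta_tail_integrable_ds)+
    note I12 = set_integral_diff[OF I1 I2] and Iab = set_integral_add[OF Ia Ib]
    note int = set_integral_diff(1)[OF I12(1) Iab(1)]
    have "(LINT x:{0..}|lborel. ?r x) = (LINT x:{0..}|lborel. ?f (w + h) (s + k) x - ?f w s x)
        - (LINT x:{0..}|lborel. h * ?a x + k * ?b x)"
      by (rule set_integral_diff(2)[OF I12(1) Iab(1)])
    also have "\<dots> = theta_tail (w + h) (s + k) - theta_tail w s - (a * h + b * k)"
      unfolding I12(2) Iab(2) set_integral_mult_right theta_tail_def a_def b_def by (simp only: mult.commute)
    finally have "norm (theta_tail (w + h) (s + k) - theta_tail w s - (a * h + b * k)) = norm (LINT x:{0..}|lborel. ?r x)"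
      by (simp only:)
    also have "\<dots> \<le> (LINT x:{0..}|lborel. norm (?r x))" by (rule set_integral_norm_bound[OF int])
    also have "\<dots> \<le> (LINT x:{0..}|lborel. (norm (h, k))\<^sup>2 * K * norm (?g x))"
    proof (rule set_integral_mono)
      fix x :: real assume "x \<in> {0..}"
      then have x: "x \<ge> 0" by simp
      have g: "norm (?g x) = log_theta x * exp ((norm s + 2) * x)"
        unfolding norm_of_real by (intro abs_of_nonneg mult_nonneg_nonneg log_theta_nonneg exp_ge_zero)
      show "norm (?r x) \<le> (norm (h, k))\<^sup>2 * K * norm (?g x)"
        unfolding g K_def B_def by (rule theta_tail_remainder[OF x that])
    next
      show "set_integrable lborel {0..} (\<lambda>x. norm (?r x))" by (rule set_integrable_norm[OF int])
      show "set_integrable lborel {0..} (\<lambda>x. (norm (h, k))\<^sup>2 * K * norm (?g x))"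
        by (intro set_integrable_mult_right set_integrable_norm[OF gint])
    qed
    also have "\<dots> = (norm (h, k))\<^sup>2 * K * M" unfolding M_def by (rule set_integral_mult_right)
    finally show ?thesis by (simp add: mult_ac)
  qed
  have lin: "bounded_linear (\<lambda>(h, k). a * h + b * k)"
    unfolding case_prod_beta by (intro bounded_linear_add bounded_linear_const_mult bounded_linear_fst bounded_linear_snd)
  have "((\<lambda>(w, s). theta_tail w s) has_derivative (\<lambda>(h, k). a * h + b * k)) (at (w, s))"
  proof (rule has_derivativeI_sandwich[of 1 _ _ _ _ "\<lambda>y. K * M * norm (y - (w, s))"])
    fix y assume y: "y \<noteq> (w, s)" "dist y (w, s) < 1"
    obtain h k where hk: "y = (w + h, s + k)" by (metis add.commute diff_add_cancel surj_pair)
    have yy: "y - (w, s) = (h, k)" by (simp add: hk)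
    have "norm (h, k) < 1" using y(2) by (simp add: dist_norm yy)
    then have "norm h \<le> 1" "norm k \<le> 1" using norm_fst_le[of h k] norm_snd_le[of k h] by auto
    from est[OF this] have "norm ((case y of (w, s) \<Rightarrow> theta_tail w s) - (case (w, s) of (w, s) \<Rightarrow> theta_tail w s)
      - (case y - (w, s) of (h, k) \<Rightarrow> a * h + b * k)) \<le> K * M * norm (h, k) * norm (h, k)"
      unfolding yy by (simp add: hk power2_eq_square mult.assoc)
    moreover have "norm (h, k) > 0" using y(1) yy by (simp only: zero_less_norm_iff) auto
    ultimately show "norm ((case y of (w, s) \<Rightarrow> theta_tail w s) - (case (w, s) of (w, s) \<Rightarrow> theta_tail w s)
      - (case y - (w, s) of (h, k) \<Rightarrow> a * h + b * k)) / norm (y - (w, s)) \<le> K * M * norm (y - (w, s))"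
      unfolding yy by (subst pos_divide_le_eq)
  next
    have "((\<lambda>y. K * M * norm (y - (w, s))) \<longlongrightarrow> K * M * norm ((w, s) - (w, s))) (at (w, s))"
      by (intro tendsto_intros)
    then show "((\<lambda>y. K * M * norm (y - (w, s))) \<longlongrightarrow> 0) (at (w, s))" by simp
  qed (use lin in auto)
  then show ?thesis by blast
qed

subsection \<open>The regularized integral over the real line\<close>

lemma set_integral_exp_neg:
  fixes c :: complex
  assumes c: "Re c < 0"
  shows "set_integrable lborel {0..} (\<lambda>x. exp (c * complex_of_real x))"
    and "(LINT x:{0..}|lborel. exp (c * complex_of_real x)) = - 1 / c"
proof -
  let ?f = "\<lambda>x. exp (c * complex_of_real x)"
  have cont: "continuous_on UNIV ?f" by (intro continuous_intros)
  then have meas: "?f \<in> borel_measurable borel" by (rule borel_measurable_continuous_onI)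
  show int: "set_integrable lborel {0..} ?f"
  proof -
    have "(\<lambda>x. indicator {0..} x *\<^sub>R ?f x) \<in> borel_measurable lborel" using meas by simp
    with set_integrable_exp_neg[OF c] show ?thesis
      unfolding set_integrable_def
      by - (erule (1) Bochner_Integration.integrable_bound, auto simp: indicator_def)
  qed
  have int': "set_integrable lborel {0<..} ?f" by (rule set_integrable_subset[OF int]) auto
  \<comment> \<open>The fundamental theorem below lives on an open interval, so the null set {0} is
    removed first.\<close>
  have eq: "(LINT x:{0..}|lborel. ?f x) = (LINT x:{0<..}|lborel. ?f x)"
    unfolding set_lebesgue_integral_def
  proof (rule integral_cong_AE)
    show "AE x in lborel. indicat_real {0..} x *\<^sub>R ?f x = indicat_real {0<..} x *\<^sub>R ?f x"
      using AE_lborel_singleton[of "0::real"] by eventually_elim (auto simp: indicator_def)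
  qed (use int int' in \<open>auto simp: set_integrable_def\<close>)
  have "(LBINT x=ereal 0..\<infinity>. ?f x) = 0 - 1 / c"
  proof (rule interval_integral_FTC_integrable)
    show "((\<lambda>x. exp (c * complex_of_real x) / c) has_vector_derivative ?f x) (at x)" for x
    proof -
      have "c \<noteq> 0" using c by auto
      then have "((\<lambda>z. exp (c * z) / c) has_field_derivative ?f x) (at (complex_of_real x))"
        by (auto intro!: derivative_eq_intros)
      from has_vector_derivative_real_field[OF this] show ?thesis by simp
    qed
    show "isCont ?f x" for x by (intro continuous_intros)
    show "set_integrable lborel (einterval (ereal 0) \<infinity>) ?f" using int' by (simp add: einterval_eq_Ici)
    have "isCont (\<lambda>x. exp (c * complex_of_real x) / c) 0" by (intro continuous_intros) (use c in auto)
    then have "((\<lambda>x. exp (c * complex_of_real x) / c) \<longlongrightarrow> 1 / c) (at_right 0)"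
      unfolding isCont_def by (auto intro: filterlim_at_split[THEN iffD1, THEN conjunct2] tendsto_within_subset)
    then show "(((\<lambda>x. exp (c * complex_of_real x) / c) \<circ> real_of_ereal) \<longlongrightarrow> 1 / c) (at_right (ereal 0))"
      by (simp only: ereal_tendsto_simps)
    have "((\<lambda>x. exp (Re c * x) / norm c) \<longlongrightarrow> 0 / norm c) at_top"
      by (intro tendsto_divide tendsto_const filterlim_compose[OF exp_at_bot]
          filterlim_tendsto_neg_mult_at_bot[OF tendsto_const c filterlim_ident]) (use c in auto)
    then have "((\<lambda>x. norm (exp (c * complex_of_real x) / c)) \<longlongrightarrow> 0) at_top" by (simp add: norm_divide)
    then have "((\<lambda>x. exp (c * complex_of_real x) / c) \<longlongrightarrow> 0) at_top" by (rule tendsto_norm_zero_cancel)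
    then show "(((\<lambda>x. exp (c * complex_of_real x) / c) \<circ> real_of_ereal) \<longlongrightarrow> 0) (at_left \<infinity>)"
      by (simp only: ereal_tendsto_simps)
  qed simp
  then show "(LINT x:{0..}|lborel. ?f x) = - 1 / c"
    unfolding eq interval_integral_to_infinity_eq by simp
qed

text \<open>By \<open>theta_powr\<close> this is the integrand of the theorem in the variable
  x.\<close>

definition mellin_kernel :: "complex \<Rightarrow> complex \<Rightarrow> real \<Rightarrow> complex" where
  "mellin_kernel w s x = (exp (w * of_real (log_theta x)) - heaviside s
     - heaviside (w - s) * exp (- w * of_real x)) * exp (s * of_real x)"

text \<open>The functional equation: by \<open>log_theta_minus\<close> the theta power gains a
  factor exp(w x), and the two Heaviside terms change places.\<close>

lemma mellin_kernel_minus: "mellin_kernel w s (- x) = mellin_kernel w (w - s) x"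
  by (simp add: mellin_kernel_def log_theta_minus algebra_simps exp_add exp_diff exp_minus divide_inverse)

text \<open>After splitting off the integrand of \<open>theta_tail\<close>, two exponentials remain.
  The one in s has a nonzero coefficient only if Re s < 0, the one in s - w only if Re s < Re w, so
  each surviving term decays.\<close>

lemma mellin_kernel_half:
  assumes "Re s \<noteq> 0" "Re s \<noteq> Re w"
  shows "set_integrable lborel {0..} (mellin_kernel w s)"
    and "(LINT x:{0..}|lborel. mellin_kernel w s x) = theta_tail w s - (1 - heaviside s) / s - heaviside (w - s) / (w - s)"
proof -
  have eq: "mellin_kernel w s = (\<lambda>x. (exp (w * of_real (log_theta x)) - 1) * exp (s * of_real x)
      + (1 - heaviside s) * exp (s * of_real x) - heaviside (w - s) * exp ((s - w) * of_real x))"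
    by (rule ext) (simp add: mellin_kernel_def algebra_simps exp_add exp_diff exp_minus divide_inverse)
  have 1: "set_integrable lborel {0..} (\<lambda>x. (1 - heaviside s) * exp (s * complex_of_real x))"
    by (intro set_integrable_mult_right set_integral_exp_neg) (use assms in \<open>auto simp: heaviside_def split: if_splits\<close>)
  have 2: "set_integrable lborel {0..} (\<lambda>x. heaviside (w - s) * exp ((s - w) * complex_of_real x))"
    by (intro set_integrable_mult_right set_integral_exp_neg) (use assms in \<open>auto simp: heaviside_def split: if_splits\<close>)
  have v1: "(LINT x:{0..}|lborel. (1 - heaviside s) * exp (s * complex_of_real x)) = - (1 - heaviside s) / s"
    using assms set_integral_exp_neg(2)[of s] by (cases "Re s < 0") (auto simp: heaviside_def)
  have v2: "(LINT x:{0..}|lborel. heaviside (w - s) * exp ((s - w) * complex_of_real x)) = heaviside (w - s) / (w - s)"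
    using assms set_integral_exp_neg(2)[of "s - w"] minus_divide_right[of 1 "s - w"]
    by (cases "Re s < Re w") (auto simp: heaviside_def)
  note a = set_integral_add[OF theta_tail_integrable[of w s] 1]
  note b = set_integral_diff[OF a(1) 2]
  show "set_integrable lborel {0..} (mellin_kernel w s)" unfolding eq by (rule b(1))
  show "(LINT x:{0..}|lborel. mellin_kernel w s x) = theta_tail w s - (1 - heaviside s) / s - heaviside (w - s) / (w - s)"
    unfolding eq b(2) a(2) v1 v2 theta_tail_def by (simp add: diff_divide_distrib)
qed

lemma continuous_on_mellin_kernel: "continuous_on UNIV (mellin_kernel w s)"
  unfolding mellin_kernel_def by (intro continuous_intros)

lemma has_bochner_integral_mellin_kernel:
  assumes "Re s \<noteq> 0" "Re s \<noteq> Re w"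
  shows "has_bochner_integral lborel (mellin_kernel w s)
    (theta_tail w s + theta_tail w (w - s) - 1 / s - 1 / (w - s))"
proof -
  let ?p = "\<lambda>s x. indicat_real {0..} x *\<^sub>R mellin_kernel w s x"
  have half: "has_bochner_integral lborel (?p s) (theta_tail w s - (1 - heaviside s) / s - heaviside (w - s) / (w - s))"
    if "Re s \<noteq> 0" "Re s \<noteq> Re w" for s
    using mellin_kernel_half[OF that]
    by (simp add: has_bochner_integral_iff set_integrable_def set_lebesgue_integral_def)
  have "has_bochner_integral lborel (?p (w - s)) (theta_tail w (w - s) - (1 - heaviside (w - s)) / (w - s) - heaviside s / s)"
    using half[of "w - s"] assms by simp
  then have "has_bochner_integral lborel (\<lambda>x. ?p (w - s) (- x)) (theta_tail w (w - s) - (1 - heaviside (w - s)) / (w - s) - heaviside s / s)"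
    using lborel_has_bochner_integral_real_affine_iff[of "-1" "?p (w - s)" _ 0] by simp
  \<comment> \<open>The reflected half supplies H(s)/s and (1 - H(w - s))/(w - s), which complete
    the two fractions of the first half, so no Heaviside value survives.\<close>
  from has_bochner_integral_add[OF half[OF assms] this]
  have "has_bochner_integral lborel (\<lambda>x. ?p s x + ?p (w - s) (- x)) (theta_tail w s + theta_tail w (w - s) - 1 / s - 1 / (w - s))"
    by (simp add: diff_divide_distrib algebra_simps)
  \<comment> \<open>At x = 0 both indicators are 1 and the value is counted twice; this point is a
    null set.\<close>
  moreover have "AE x in lborel. mellin_kernel w s x = ?p s x + ?p (w - s) (- x)"
    using AE_lborel_singleton[of "0::real"]
    by eventually_elim (auto simp: indicator_def mellin_kernel_minus)
  moreover have "mellin_kernel w s \<in> borel_measurable lborel"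
    using borel_measurable_continuous_onI[OF continuous_on_mellin_kernel] by simp
  ultimately show ?thesis
    using has_bochner_integral_cong_AE borel_measurable_has_bochner_integral by blast
qed

section \<open>The substitution t = exp x\<close>

lemma set_integral_substitution_exp:
  fixes f :: "real \<Rightarrow> complex"
  assumes cont: "continuous_on {0<..} f" and int: "integrable lborel (\<lambda>x. exp x *\<^sub>R f (exp x))"
  shows "set_integrable lborel {0<..} f"
    and "(LINT t:{0<..}|lborel. f t) = (LINT x|lborel. exp x *\<^sub>R f (exp x))"
proof -
  have icf: "isCont f t" if "t > 0" for t using cont that by (simp add: continuous_on_eq_continuous_at)
  have lim0: "((ereal \<circ> exp \<circ> real_of_ereal) \<longlongrightarrow> ereal 0) (at_right (-\<infinity>))"
    unfolding ereal_tendsto_simps using exp_at_bot by (simp add: o_def)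
  have liminf: "((ereal \<circ> exp \<circ> real_of_ereal) \<longlongrightarrow> \<infinity>) (at_left \<infinity>)"
    unfolding ereal_tendsto_simps using exp_at_top by simp
  have "einterval (- \<infinity>) \<infinity> = UNIV" "einterval (ereal 0) \<infinity> = {0<..}" by (auto simp: einterval_def)
  note ei = this
  \<comment> \<open>The substitution rule for complex values needs integrability in both variables.
    In t it is obtained from the nonnegative version applied to the norm of
    \<open>f\<close>.\<close>
  have "set_integrable lborel (einterval (ereal 0) \<infinity>) (\<lambda>t. norm (f t))"
  proof (rule interval_integral_substitution_nonneg(1)[where g = exp and g' = exp and a = "-\<infinity>" and b = \<infinity>])
    show "isCont (\<lambda>t. norm (f t)) (exp x)" for x by (intro continuous_intros icf) simp
    show "set_integrable lborel (einterval (- \<infinity>) \<infinity>) (\<lambda>x. norm (f (exp x)) * exp x)"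
      using integrable_norm[OF int] by (simp add: ei set_integrable_def mult.commute)
  qed (use lim0 liminf in \<open>auto intro: derivative_intros continuous_intros\<close>)
  then have "integrable lborel (\<lambda>t. norm (indicat_real {0<..} t *\<^sub>R f t))"
    by (simp add: ei set_integrable_def)
  moreover have "(\<lambda>t. indicat_real {0<..} t *\<^sub>R f t) \<in> borel_measurable lborel"
    using borel_measurable_continuous_on_indicator[OF _ cont] by simp
  ultimately show si: "set_integrable lborel {0<..} f"
    unfolding set_integrable_def by (simp only: integrable_norm_iff)
  have "(LBINT x=ereal 0..\<infinity>. f x) = (LBINT x=-\<infinity>..\<infinity>. exp x *\<^sub>R f (exp x))"
  proof (rule interval_integral_substitution_integrable)
    show "isCont f (exp x)" for x by (intro icf) simp
  qed (use lim0 liminf int si in \<open>auto intro: derivative_intros continuous_intros simp: ei set_integrable_def\<close>)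
  then show "(LINT t:{0<..}|lborel. f t) = (LINT x|lborel. exp x *\<^sub>R f (exp x))"
    by (simp add: interval_lebesgue_integral_def ei set_lebesgue_integral_def)
qed

subsection \<open>Meromorphic continuation\<close>

lemma theta_square_powr:
  "complex_of_real (theta ((exp x)\<^sup>2)) powr w = exp (w * of_real (log_theta x))"
  using theta_powr[of x w] by (simp add: exp_double)

lemma exp_powr: "complex_of_real (exp x) powr s = exp (s * of_real x)"
  by (simp add: powr_def Ln_of_real mult.commute)

lemma continuous_on_theta [continuous_intros]:
  "continuous_on S f \<Longrightarrow> (\<And>x. x \<in> S \<Longrightarrow> f x > 0) \<Longrightarrow> continuous_on S (\<lambda>x. theta (f x))"
  by (rule continuous_on_compose2[of "{0<..}" theta])
    (auto intro!: continuous_at_imp_continuous_on isCont_theta)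

lemma continuous_on_of_real_powr [continuous_intros]:
  fixes f :: "'a::topological_space \<Rightarrow> real"
  assumes "continuous_on S f" and pos: "\<And>x. x \<in> S \<Longrightarrow> f x > 0"
  shows "continuous_on S (\<lambda>x. complex_of_real (f x) powr w)"
proof (rule continuous_on_eq)
  show "continuous_on S (\<lambda>x. exp (w * of_real (ln (f x))))"
    by (intro continuous_intros assms(1)) (use pos in force)
qed (use pos in \<open>force simp: powr_def Ln_of_real mult.commute\<close>)

lemma theta_pos: "t > 0 \<Longrightarrow> theta t > 0"
  using theta_ge_1[of t] by simp

lemma mellin_integral:
  assumes "Re s \<noteq> 0" "Re s \<noteq> Re w"
  defines "f \<equiv> \<lambda>t::real. (complex_of_real (theta (t\<^sup>2)) powr w - heaviside s
              - heaviside (w - s) * complex_of_real t powr (- w)) * complex_of_real t powr s / complex_of_real t"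
  shows "set_integrable lborel {0<..} f"
    and "(LINT t:{0<..}|lborel. f t) = theta_tail w s + theta_tail w (w - s) - 1 / s - 1 / (w - s)"
proof -
  have eq: "exp x *\<^sub>R f (exp x) = mellin_kernel w s x" for x
    unfolding f_def theta_square_powr exp_powr mellin_kernel_def by (simp add: scaleR_conv_of_real)
  have cont: "continuous_on {0<..} f"
    unfolding f_def by (intro continuous_intros) (auto intro: theta_pos)
  note K = has_bochner_integral_mellin_kernel[OF assms(1,2)]
  have int: "integrable lborel (\<lambda>x. exp x *\<^sub>R f (exp x))"
    using K by (simp only: eq has_bochner_integral_iff)
  note sub = set_integral_substitution_exp[OF cont int]
  show "set_integrable lborel {0<..} f" by (rule sub(1))
  show "(LINT t:{0<..}|lborel. f t) = theta_tail w s + theta_tail w (w - s) - 1 / s - 1 / (w - s)"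
    using K unfolding sub(2) eq has_bochner_integral_iff by simp
qed

text \<open>Here both Heaviside values vanish, and with L = \<open>log_theta x\<close> the exponent
  s L + (w - s)(L + x) equals w L + (w - s) x. So the integrand is the kernel at w - s, and the
  formula is invariant under s to w - s.\<close>

lemma ZQ_integral_eq:
  assumes "Re w < Re s" "Re s < 0"
  shows "ZQ_integral w s = theta_tail w s + theta_tail w (w - s) - 1 / s - 1 / (w - s)"
proof -
  let ?f = "\<lambda>t. complex_of_real (theta (t\<^sup>2)) powr s * complex_of_real (theta (1 / t\<^sup>2)) powr (w - s) / complex_of_real t"
  have h: "heaviside s = 0" "heaviside (w - s) = 0" using assms by (auto simp: heaviside_def)
  have eq: "exp x *\<^sub>R ?f (exp x) = mellin_kernel w (w - s) x" for x
  proof -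
    have "1 / (exp x)\<^sup>2 = (exp (- x))\<^sup>2" by (simp add: exp_minus power_inverse divide_inverse)
    then have "exp x *\<^sub>R ?f (exp x) = exp (s * of_real (log_theta x)) * exp ((w - s) * of_real (log_theta x + x))"
      by (simp only: theta_square_powr log_theta_minus) (simp add: scaleR_conv_of_real)
    then show ?thesis by (simp add: mellin_kernel_def h exp_add[symmetric] algebra_simps)
  qed
  have cont: "continuous_on {0<..} ?f" by (intro continuous_intros) (auto intro: theta_pos)
  have K: "has_bochner_integral lborel (mellin_kernel w (w - s))
      (theta_tail w (w - s) + theta_tail w (w - (w - s)) - 1 / (w - s) - 1 / (w - (w - s)))"
    by (rule has_bochner_integral_mellin_kernel) (use assms in auto)
  have int: "integrable lborel (\<lambda>x. exp x *\<^sub>R ?f (exp x))"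
    using K by (simp only: eq has_bochner_integral_iff)
  show ?thesis
    using K unfolding ZQ_integral_def set_integral_substitution_exp(2)[OF cont int] eq has_bochner_integral_iff by simp
qed

section \<open>Complex differentiability in two variables\<close>

text \<open>The pointwise form of \<open>holomorphic2_on\<close>: closure rules can be collected for
  it, and nonvanishing conditions concern one point only.\<close>

definition complex_differentiable2 :: "(complex \<times> complex \<Rightarrow> complex) \<Rightarrow> complex \<times> complex \<Rightarrow> bool" where
  "complex_differentiable2 f p \<longleftrightarrow> (\<exists>a b. (f has_derivative (\<lambda>(h, k). a * h + b * k)) (at p))"

named_theorems cdiff2_intros

lemma complex_differentiable2_const [cdiff2_intros]: "complex_differentiable2 (\<lambda>_. c) p"
  unfolding complex_differentiable2_def by (rule exI[of _ 0], rule exI[of _ 0]) (simp add: case_prod_beta')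

lemma complex_differentiable2_fst [cdiff2_intros]: "complex_differentiable2 fst p"
  unfolding complex_differentiable2_def
  by (rule exI[of _ 1], rule exI[of _ 0]) (auto simp: case_prod_beta intro!: derivative_eq_intros)

lemma complex_differentiable2_snd [cdiff2_intros]: "complex_differentiable2 snd p"
  unfolding complex_differentiable2_def
  by (rule exI[of _ 0], rule exI[of _ 1]) (auto simp: case_prod_beta intro!: derivative_eq_intros)

lemma complex_differentiable2_add [cdiff2_intros]:
  assumes "complex_differentiable2 f p" "complex_differentiable2 g p"
  shows "complex_differentiable2 (\<lambda>q. f q + g q) p"
proof -
  from assms obtain a b c d where "(f has_derivative (\<lambda>(h, k). a * h + b * k)) (at p)"
    "(g has_derivative (\<lambda>(h, k). c * h + d * k)) (at p)" unfolding complex_differentiable2_def by blast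
  from has_derivative_add[OF this] have "((\<lambda>q. f q + g q) has_derivative (\<lambda>(h, k). (a + c) * h + (b + d) * k)) (at p)"
    by (simp add: case_prod_beta' algebra_simps)
  then show ?thesis unfolding complex_differentiable2_def by blast
qed

lemma complex_differentiable2_mult [cdiff2_intros]:
  assumes "complex_differentiable2 f p" "complex_differentiable2 g p"
  shows "complex_differentiable2 (\<lambda>q. f q * g q) p"
proof -
  from assms obtain a b c d where "(f has_derivative (\<lambda>(h, k). a * h + b * k)) (at p)"
    "(g has_derivative (\<lambda>(h, k). c * h + d * k)) (at p)" unfolding complex_differentiable2_def by blast
  from has_derivative_mult[OF this]
  have "((\<lambda>q. f q * g q) has_derivative (\<lambda>(h, k). (f p * c + a * g p) * h + (f p * d + b * g p) * k)) (at p)"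
    by (simp add: case_prod_beta' algebra_simps)
  then show ?thesis unfolding complex_differentiable2_def by blast
qed

lemma complex_differentiable2_diff [cdiff2_intros]:
  assumes "complex_differentiable2 f p" "complex_differentiable2 g p"
  shows "complex_differentiable2 (\<lambda>q. f q - g q) p"
  using complex_differentiable2_add[OF assms(1) complex_differentiable2_mult[OF complex_differentiable2_const[of "-1"] assms(2)]]
  by simp

lemma complex_differentiable2_inverse [cdiff2_intros]:
  assumes "complex_differentiable2 f p" "f p \<noteq> 0"
  shows "complex_differentiable2 (\<lambda>q. inverse (f q)) p"
proof -
  from assms obtain a b where "(f has_derivative (\<lambda>(h, k). a * h + b * k)) (at p)"
    unfolding complex_differentiable2_def by blast
  from Deriv.has_derivative_inverse[OF assms(2) this]
  have "((\<lambda>q. inverse (f q)) has_derivative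
      (\<lambda>(h, k). (- inverse (f p) * a * inverse (f p)) * h + (- inverse (f p) * b * inverse (f p)) * k)) (at p)"
    by (simp add: case_prod_beta' algebra_simps)
  then show ?thesis unfolding complex_differentiable2_def by blast
qed

lemma complex_differentiable2_theta_tail [cdiff2_intros]:
  "complex_differentiable2 (\<lambda>q. theta_tail (fst q) (snd q)) p"
  using theta_tail_has_derivative[of "fst p" "snd p"]
  by (simp add: complex_differentiable2_def case_prod_beta')

lemma complex_differentiable2_theta_tail_reflected [cdiff2_intros]:
  "complex_differentiable2 (\<lambda>q. theta_tail (fst q) (fst q - snd q)) p"
proof -
  obtain a b where ab: "((\<lambda>(w, s). theta_tail w s) has_derivative (\<lambda>(h, k). a * h + b * k)) (at (fst p, fst p - snd p))"
    using theta_tail_has_derivative by blast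
  have "((\<lambda>q. (fst q, fst q - snd q)) has_derivative (\<lambda>q. (fst q, fst q - snd q))) (at p)"
    by (auto intro!: derivative_eq_intros)
  from has_derivative_compose[OF this ab]
  have "((\<lambda>q. theta_tail (fst q) (fst q - snd q)) has_derivative (\<lambda>(h, k). (a + b) * h + (- b) * k)) (at p)"
    by (simp add: case_prod_beta' algebra_simps)
  then show ?thesis unfolding complex_differentiable2_def by blast
qed

lemma holomorphic2_on_iff: "holomorphic2_on f S \<longleftrightarrow> (\<forall>p\<in>S. complex_differentiable2 f p)"
  by (simp add: holomorphic2_on_def complex_differentiable2_def)

section \<open>The explicit continuation\<close>

text \<open>The value 0 on the polar lines matches the normalization in
  \<open>is_ZQ_continuation\<close>.\<close>

definition ZQ_formula :: "complex \<times> complex \<Rightarrow> complex" where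
  "ZQ_formula = (\<lambda>(w, s). if s = 0 \<or> s = w then 0
     else theta_tail w s + theta_tail w (w - s) - 1 / s - 1 / (w - s))"

lemma open_off_poles: "open {(w, s). s \<noteq> 0 \<and> s \<noteq> (w::complex)}"
proof -
  have "{(w, s). s \<noteq> 0 \<and> s \<noteq> (w::complex)} = {q. snd q \<noteq> 0} \<inter> {q. snd q \<noteq> fst q}" by auto
  also have "open \<dots>" by (intro open_Int open_Collect_neq continuous_intros)
  finally show ?thesis .
qed

lemma ZQ_formula_holomorphic: "holomorphic2_on ZQ_formula {(w, s). s \<noteq> 0 \<and> s \<noteq> w}"
  unfolding holomorphic2_on_iff
proof
  fix p :: "complex \<times> complex" assume p: "p \<in> {(w, s). s \<noteq> 0 \<and> s \<noteq> w}"
  let ?g = "\<lambda>q. theta_tail (fst q) (snd q) + theta_tail (fst q) (fst q - snd q) - inverse (snd q) - inverse (fst q - snd q)"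
  have "complex_differentiable2 ?g p" by (intro cdiff2_intros) (use p in auto)
  then obtain a b where "(?g has_derivative (\<lambda>(h, k). a * h + b * k)) (at p)"
    unfolding complex_differentiable2_def by blast
  then have "(ZQ_formula has_derivative (\<lambda>(h, k). a * h + b * k)) (at p)"
    by (rule has_derivative_transform_within_open[OF _ open_off_poles p])
      (auto simp: ZQ_formula_def divide_inverse)
  then show "complex_differentiable2 ZQ_formula p" unfolding complex_differentiable2_def by blast
qed

lemma ZQ_formula_meromorphic: "meromorphic2_on ZQ_formula UNIV"
proof -
  \<comment> \<open>A single global quotient serves at every point: 1/s + 1/(w - s) = w/(s (w - s)),
    whence the final \<open>fst q\<close> in the numerator.\<close>
  let ?h = "\<lambda>q::complex \<times> complex. snd q * (fst q - snd q)"
  let ?g = "\<lambda>q. (theta_tail (fst q) (snd q) + theta_tail (fst q) (fst q - snd q)) * (snd q * (fst q - snd q)) - fst q"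
  have "holomorphic2_on ?h UNIV" "holomorphic2_on ?g UNIV"
    unfolding holomorphic2_on_iff by (intro ballI cdiff2_intros)+
  moreover have "?h (2, 1) \<noteq> 0" by simp
  moreover have "ZQ_formula q = ?g q / ?h q" if "?h q \<noteq> 0" for q
    using that by (auto simp: ZQ_formula_def case_prod_beta field_simps)
  ultimately show ?thesis
    unfolding meromorphic2_on_def by (intro ballI exI[of _ UNIV] exI[of _ ?g] exI[of _ ?h]) (auto intro!: bexI[of _ "(2, 1)"])
qed

lemma ZQ_formula_continuation: "is_ZQ_continuation ZQ_formula"
  unfolding is_ZQ_continuation_def
  using ZQ_formula_meromorphic ZQ_formula_holomorphic
  by (auto simp: ZQ_formula_def ZQ_integral_eq)

section \<open>Uniqueness of the continuation\<close>

lemma connected_minus_two_points: "connected (- {a, b :: complex})"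
  by (rule path_connected_imp_connected[OF path_connected_complement_countable]) auto

lemma holomorphic2_on_slices:
  assumes "holomorphic2_on f S"
  shows "(\<lambda>s. f (w, s)) holomorphic_on {s. (w, s) \<in> S}" and "(\<lambda>w. f (w, s)) holomorphic_on {w. (w, s) \<in> S}"
proof -
  have d: "\<exists>a b. (f has_derivative (\<lambda>(h, k). a * h + b * k)) (at (w, s))" if "(w, s) \<in> S" for w s
    using assms that unfolding holomorphic2_on_def by blast
  have "(\<lambda>s. f (w, s)) field_differentiable at s" if ws: "(w, s) \<in> S" for s
  proof -
    obtain a b where ab: "(f has_derivative (\<lambda>(h, k). a * h + b * k)) (at (w, s))" using d[OF ws] by blast
    have "((\<lambda>s. (w, s)) has_derivative (\<lambda>k. (0, k))) (at s)" by (auto intro!: derivative_eq_intros)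
    from has_derivative_compose[OF this ab] have "((\<lambda>s. f (w, s)) has_derivative (*) b) (at s)" by simp
    then show ?thesis unfolding field_differentiable_def has_field_derivative_def by blast
  qed
  then show "(\<lambda>s. f (w, s)) holomorphic_on {s. (w, s) \<in> S}"
    unfolding holomorphic_on_def using field_differentiable_at_within by blast
  have "(\<lambda>w. f (w, s)) field_differentiable at w" if ws: "(w, s) \<in> S" for w
  proof -
    obtain a b where ab: "(f has_derivative (\<lambda>(h, k). a * h + b * k)) (at (w, s))" using d[OF ws] by blast
    have "((\<lambda>w. (w, s)) has_derivative (\<lambda>h. (h, 0))) (at w)" by (auto intro!: derivative_eq_intros)
    from has_derivative_compose[OF this ab] have "((\<lambda>w. f (w, s)) has_derivative (*) a) (at w)" by simp
    then show ?thesis unfolding field_differentiable_def has_field_derivative_def by blast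
  qed
  then show "(\<lambda>w. f (w, s)) holomorphic_on {w. (w, s) \<in> S}"
    unfolding holomorphic_on_def using field_differentiable_at_within by blast
qed

lemma ZQ_continuation_unique:
  assumes f: "is_ZQ_continuation f" and g: "is_ZQ_continuation g"
  shows "f = g"
proof -
  let ?D = "{(w, s). s \<noteq> 0 \<and> s \<noteq> (w::complex)}"
  have hf: "holomorphic2_on f ?D" and hg: "holomorphic2_on g ?D"
    and pole: "\<And>w s. s = 0 \<or> s = w \<Longrightarrow> f (w, s) = g (w, s)"
    and base: "\<And>w s. Re w < Re s \<Longrightarrow> Re s < 0 \<Longrightarrow> f (w, s) = g (w, s)"
    using f g by (auto simp: is_ZQ_continuation_def)
  have s1: "{s. (w, s) \<in> ?D} = - {0, w}" for w by auto
  \<comment> \<open>For fixed nonzero s only w = s is excluded; the doubled point fits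
    \<open>connected_minus_two_points\<close>.\<close>
  have s2: "{w. (w, s) \<in> ?D} = - {s, s}" if "s \<noteq> 0" for s using that by auto
  \<comment> \<open>For Re w < 0 the strip Re w < Re s < 0, where both functions are the integral,
    is nonempty, and the s-plane without 0 and w is connected.\<close>
  have left: "f (w, s) = g (w, s)" if w: "Re w < 0" and s: "s \<noteq> 0" "s \<noteq> w" for w s
  proof (rule analytic_continuation_open[where s = "{s. Re w < Re s \<and> Re s < 0}" and s' = "- {0, w}"
      and f = "\<lambda>s. f (w, s)" and g = "\<lambda>s. g (w, s)"])
    show "open {s. Re w < Re s \<and> Re s < 0}"
      by (intro open_Collect_conj open_Collect_less continuous_intros)
    have "complex_of_real (Re w / 2) \<in> {s. Re w < Re s \<and> Re s < 0}" using w by simp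
    then show "{s. Re w < Re s \<and> Re s < 0} \<noteq> {}" by blast
    show "open (- {0, w})" by (intro open_Compl finite_imp_closed) auto
    show "(\<lambda>s. f (w, s)) holomorphic_on - {0, w}" using holomorphic2_on_slices(1)[OF hf, of w] by (simp only: s1)
    show "(\<lambda>s. g (w, s)) holomorphic_on - {0, w}" using holomorphic2_on_slices(1)[OF hg, of w] by (simp only: s1)
  qed (use s base connected_minus_two_points in auto)
  \<comment> \<open>Now s is fixed. On the half-plane Re w < min(0, Re s) one has s \<noteq> w, so
    \<open>left\<close> gives agreement there, and it spreads to all w \<noteq> s.\<close>
  have "f (w, s) = g (w, s)" if s: "s \<noteq> 0" "s \<noteq> w" for w s
  proof (rule analytic_continuation_open[where s = "{w. Re w < 0 \<and> Re w < Re s}" and s' = "- {s, s}"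
      and f = "\<lambda>w. f (w, s)" and g = "\<lambda>w. g (w, s)"])
    show "open {w. Re w < 0 \<and> Re w < Re s}"
      by (intro open_Collect_conj open_Collect_less continuous_intros)
    have "complex_of_real (min 0 (Re s) - 1) \<in> {w. Re w < 0 \<and> Re w < Re s}" by auto
    then show "{w. Re w < 0 \<and> Re w < Re s} \<noteq> {}" by blast
    show "open (- {s, s})" by (intro open_Compl finite_imp_closed) auto
    show "(\<lambda>w. f (w, s)) holomorphic_on - {s, s}" using holomorphic2_on_slices(2)[OF hf, of s] by (simp only: s2[OF s(1)])
    show "(\<lambda>w. g (w, s)) holomorphic_on - {s, s}" using holomorphic2_on_slices(2)[OF hg, of s] by (simp only: s2[OF s(1)])
    show "connected (- {s, s})" by (rule connected_minus_two_points)
    show "f (w, s) = g (w, s)" if "w \<in> {w. Re w < 0 \<and> Re w < Re s}" for w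
      by (rule left) (use that s in auto)
  qed (use s in auto)
  then show ?thesis using pole by (auto simp: fun_eq_iff)
qed

lemma ZQ_eq: "ZQ w s = ZQ_formula (w, s)"
  unfolding ZQ_def using ZQ_formula_continuation ZQ_continuation_unique by (subst the_equality) auto

theorem theorem2p2:
  fixes w s :: complex
  assumes "Re s \<notin> {Re w, 0}" and "s \<noteq> 0" and "s \<noteq> w"
  shows "set_integrable lborel {0<..} (\<lambda>t::real.
           (complex_of_real (theta (t\<^sup>2)) powr w - heaviside s
              - heaviside (w - s) * complex_of_real t powr (- w))
           * complex_of_real t powr s / complex_of_real t) \<and>
         integrable lborel (\<lambda>x::real.
           (complex_of_real (theta (exp (2 * x))) powr w - heaviside s
              - heaviside (w - s) * exp (- w * complex_of_real x))
           * exp (s * complex_of_real x)) \<and>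
         ZQ w s = (LINT t:{0<..}|lborel.
           (complex_of_real (theta (t\<^sup>2)) powr w - heaviside s
              - heaviside (w - s) * complex_of_real t powr (- w))
           * complex_of_real t powr s / complex_of_real t) \<and>
         ZQ w s = (LINT x|lborel.
           (complex_of_real (theta (exp (2 * x))) powr w - heaviside s
              - heaviside (w - s) * exp (- w * complex_of_real x))
           * exp (s * complex_of_real x))"
proof -
  have ws: "Re s \<noteq> 0" "Re s \<noteq> Re w" using assms(1) by auto
  have Z: "ZQ w s = theta_tail w s + theta_tail w (w - s) - 1 / s - 1 / (w - s)"
    using assms(2,3) by (simp add: ZQ_eq ZQ_formula_def)
  have K: "mellin_kernel w s = (\<lambda>x. (complex_of_real (theta (exp (2 * x))) powr w - heaviside s
              - heaviside (w - s) * exp (- w * complex_of_real x)) * exp (s * complex_of_real x))"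
    unfolding theta_powr by (rule ext) (rule mellin_kernel_def)
  show ?thesis
    using mellin_integral[OF ws] has_bochner_integral_mellin_kernel[OF ws]
    unfolding Z K has_bochner_integral_iff by simp
qed

end
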